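(* Let $A$ be a JB-algebra and let $a,b\in A_+^\circ$ be linearly independent. Then there exists a unique Thompson geodesic between $a$ and $b$ if and only if $\sigma(U_{a^{-1/2}}b)=\{\beta^{-1},\beta\}$ for some $\beta>1$.
   Context: A JB-algebra is a real Banach space $A$ with a commutative bilinear product $\circ$ satisfying $a\circ(b\circ a^2)=(a\circ b)\circ a^2$, $\|a\circ b\|\le\|a\|\|b\|$, $\|a^2\|=\|a\|^2$ and $\|a^2\|\le\|a^2+b^2\|$ for all $a,b$; all JB-algebras are assumed to have a unit $e$. $\sigma(a)$ is the spectrum of $a$. $A_+=\{a^2: a\in A\}$ is the cone, $\le$ the induced partial order, and $A_+^\circ$ its interior (elements with strictly positive spectrum). Powers are defined by the continuous functional calculus, and $U_ab=2a\circ(a\circ b)-a^2\circ b$. With $M(a/b)=\inf\{\beta>0:a\le\beta b\}$, Thompson's metric on $A_+^\circ$ is $d_T(a,b)=\log\max\{M(a/b),M(b/a)\}$. In a metric space $(X,d)$, a geodesic path is a map $\gamma\colon I\to X$ on an interval $I\subseteq\mathbb{R}$ for which there is $k\ge0$ with $d(\gamma(s),\gamma(t))=k|s-t|$ for all $s,t\in I$; its image is called a geodesic. A geodesic between $x$ and $y$ is the image of a geodesic path on a compact interval with endpoints $x$ and $y$; a Thompson geodesic is a geodesic in $(A_+^\circ,d_T)$. *)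

theory Defs
  imports "HOL-Analysis.Analysis"
begin

class jb_algebra = banach +
  fixes jprod :: "'a \<Rightarrow> 'a \<Rightarrow> 'a"  (infixl "\<bullet>\<^sub>J" 70)
    and jb_unit :: 'a
  assumes jprod_commute: "a \<bullet>\<^sub>J b = b \<bullet>\<^sub>J a"
    and jprod_add_left: "(a + b) \<bullet>\<^sub>J c = a \<bullet>\<^sub>J c + b \<bullet>\<^sub>J c"
    and jprod_scaleR_left: "(r *\<^sub>R a) \<bullet>\<^sub>J b = r *\<^sub>R (a \<bullet>\<^sub>J b)"
    and jordan_identity: "a \<bullet>\<^sub>J (b \<bullet>\<^sub>J (a \<bullet>\<^sub>J a)) = (a \<bullet>\<^sub>J b) \<bullet>\<^sub>J (a \<bullet>\<^sub>J a)"
    and jprod_unit_left: "jb_unit \<bullet>\<^sub>J a = a"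
    and norm_jprod_le: "norm (a \<bullet>\<^sub>J b) \<le> norm a * norm b"
    and norm_jsquare: "norm (a \<bullet>\<^sub>J a) = (norm a)\<^sup>2"
    and norm_jsquare_le: "norm (a \<bullet>\<^sub>J a) \<le> norm (a \<bullet>\<^sub>J a + b \<bullet>\<^sub>J b)"

definition jb_cone :: "'a::jb_algebra set" where
  "jb_cone = {a \<bullet>\<^sub>J a | a. True}"

definition jb_le :: "'a::jb_algebra \<Rightarrow> 'a \<Rightarrow> bool"  (infix "\<le>\<^sub>J" 50) where
  "a \<le>\<^sub>J b \<longleftrightarrow> b - a \<in> jb_cone"

abbreviation jb_cone_interior :: "'a::jb_algebra set" where
  "jb_cone_interior \<equiv> interior jb_cone"

text \<open>Invertibility in the Jordan sense: the second equation cannot be dropped, since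
  \<open>a \<bullet>\<^sub>J b = e\<close> alone does not determine \<open>b\<close>.\<close>

definition jb_invertible :: "'a::jb_algebra \<Rightarrow> bool" where
  "jb_invertible a \<longleftrightarrow> (\<exists>b. a \<bullet>\<^sub>J b = jb_unit \<and> (a \<bullet>\<^sub>J a) \<bullet>\<^sub>J b = a)"

definition jb_spectrum :: "'a::jb_algebra \<Rightarrow> real set" where
  "jb_spectrum a = {t. \<not> jb_invertible (a - t *\<^sub>R jb_unit)}"

definition quad_rep :: "'a::jb_algebra \<Rightarrow> 'a \<Rightarrow> 'a" where
  "quad_rep a b = 2 *\<^sub>R (a \<bullet>\<^sub>J (a \<bullet>\<^sub>J b)) - (a \<bullet>\<^sub>J a) \<bullet>\<^sub>J b"

text \<open>The functional calculus of \<open>a\<close> is the isometric unital homomorphism from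
  \<open>C(\<sigma>(a))\<close> into the algebra that sends the identity function to \<open>a\<close>. Elements of
  \<open>C(\<sigma>(a))\<close> are represented by total functions continuous on \<open>\<sigma>(a)\<close>; the isometry
  condition makes the values depend only on the restriction to \<open>\<sigma>(a)\<close>.\<close>

definition functional_calculus :: "'a::jb_algebra \<Rightarrow> ((real \<Rightarrow> real) \<Rightarrow> 'a) \<Rightarrow> bool" where
  "functional_calculus a \<Phi> \<longleftrightarrow>
     (\<forall>f g. continuous_on (jb_spectrum a) f \<longrightarrow> continuous_on (jb_spectrum a) g \<longrightarrow>
        \<Phi> (\<lambda>t. f t + g t) = \<Phi> f + \<Phi> g \<and> \<Phi> (\<lambda>t. f t * g t) = \<Phi> f \<bullet>\<^sub>J \<Phi> g) \<and>
     (\<forall>r f. continuous_on (jb_spectrum a) f \<longrightarrow> \<Phi> (\<lambda>t. r * f t) = r *\<^sub>R \<Phi> f) \<and>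
     (\<forall>f. continuous_on (jb_spectrum a) f \<longrightarrow> norm (\<Phi> f) = (SUP t\<in>jb_spectrum a. \<bar>f t\<bar>)) \<and>
     \<Phi> (\<lambda>t. 1) = jb_unit \<and> \<Phi> (\<lambda>t. t) = a"

definition jb_fun :: "(real \<Rightarrow> real) \<Rightarrow> 'a::jb_algebra \<Rightarrow> 'a" where
  "jb_fun f a = (THE x. \<exists>\<Phi>. functional_calculus a \<Phi> \<and> x = \<Phi> f)"

definition jb_powr :: "'a::jb_algebra \<Rightarrow> real \<Rightarrow> 'a"  (infixr "powr\<^sub>J" 80) where
  "a powr\<^sub>J s = jb_fun (\<lambda>t. t powr s) a"

definition M_gauge :: "'a::jb_algebra \<Rightarrow> 'a \<Rightarrow> real" where
  "M_gauge a b = Inf {\<beta>. 0 < \<beta> \<and> a \<le>\<^sub>J \<beta> *\<^sub>R b}"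

definition thompson_dist :: "'a::jb_algebra \<Rightarrow> 'a \<Rightarrow> real" where
  "thompson_dist a b = ln (max (M_gauge a b) (M_gauge b a))"

definition geodesic_path :: "'a set \<Rightarrow> ('a \<Rightarrow> 'a \<Rightarrow> real) \<Rightarrow> real set \<Rightarrow> (real \<Rightarrow> 'a) \<Rightarrow> bool" where
  "geodesic_path X d I \<gamma> \<longleftrightarrow> is_interval I \<and> \<gamma> ` I \<subseteq> X \<and>
     (\<exists>k\<ge>0. \<forall>s\<in>I. \<forall>t\<in>I. d (\<gamma> s) (\<gamma> t) = k * \<bar>s - t\<bar>)"

definition geodesic_between ::
  "'a set \<Rightarrow> ('a \<Rightarrow> 'a \<Rightarrow> real) \<Rightarrow> 'a \<Rightarrow> 'a \<Rightarrow> 'a set \<Rightarrow> bool" where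
  "geodesic_between X d x y G \<longleftrightarrow>
     (\<exists>s t \<gamma>. s \<le> t \<and> geodesic_path X d {s..t} \<gamma> \<and> \<gamma> s = x \<and> \<gamma> t = y \<and> G = \<gamma> ` {s..t})"

abbreviation thompson_geodesic :: "'a::jb_algebra \<Rightarrow> 'a \<Rightarrow> 'a set \<Rightarrow> bool" where
  "thompson_geodesic \<equiv> geodesic_between jb_cone_interior thompson_dist"

end

(* U at a^(-1/2) is an order automorphism of the cone, hence a Thompson isometry, and maps a to the
   unit e; so assume a = e.  On C(sigma(b)) the Thompson distance from exp u to exp v is the sup norm of
   u - v.  If |ln| is not constantly equal to its maximum r on sigma(b), the geodesic s * ln can
   be perturbed where |ln| < r; hence uniqueness forces sigma(b) to be a subset of {exp (-r), exp r}.
   Conversely, if b = p / beta + beta q with complementary idempotents p and q, a point z at the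
   right distances from e and b satisfies 0 <= z - e / mu <= k q and 0 <= mu e - z <= k' p, and
   such elements are annihilated by p and by q, respectively, so that z = p / mu + mu q. *)
theory Submission
  imports Defs "HOL-Computational_Algebra.Fundamental_Theorem_Algebra"
begin

section \<open>Linearised Jordan identities and power associativity\<close>

text \<open>The main obstacle is positivity of \<open>quad_rep c\<close> for positive
  \<open>c\<close>, usually read off from the Shirshov-Cohn theorem, which places the subalgebra
  generated by two elements inside an associative algebra. Here functions of an element are formed
  only in the closed subalgebra generated by that single element, which is associative; any further
  element enters as the argument of multiplication operators that commute. This gives
  multiplicativity of \<open>quad_rep\<close> along the powers of \<open>a\<close>, so that
  positivity can be obtained by splitting \<open>quad_rep a\<close> into many factors close to the
  identity. The order is handled through the norm: \<open>y\<close> is positive iff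
  \<open>norm (\<alpha> *\<^sub>R \<one>\<^sub>J - y) \<le> \<alpha>\<close> for some \<alpha>. The
  spectrum in turn is handled through the order: a Jordan inverse may lie anywhere in the algebra,
  but its existence is equivalent to a lower bound \<epsilon> e for x^2. In the converse direction
  only two inequalities about a point of a geodesic are used, its distances from e and from
  \<open>b\<close>; they already determine the point, so every geodesic has the same image.\<close>

notation jb_unit ("\<one>\<^sub>J")

interpretation jprod: bounded_bilinear "(\<bullet>\<^sub>J) :: 'a::jb_algebra \<Rightarrow> 'a \<Rightarrow> 'a"
proof
  fix a b c :: 'a and r :: real
  show "(a + b) \<bullet>\<^sub>J c = a \<bullet>\<^sub>J c + b \<bullet>\<^sub>J c" by (rule jprod_add_left)
  show "a \<bullet>\<^sub>J (b + c) = a \<bullet>\<^sub>J b + a \<bullet>\<^sub>J c"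
    by (metis jprod_add_left jprod_commute)
  show "(r *\<^sub>R a) \<bullet>\<^sub>J b = r *\<^sub>R (a \<bullet>\<^sub>J b)" by (rule jprod_scaleR_left)
  show "a \<bullet>\<^sub>J (r *\<^sub>R b) = r *\<^sub>R (a \<bullet>\<^sub>J b)"
    by (metis jprod_scaleR_left jprod_commute)
  show "\<exists>K. \<forall>a b :: 'a. norm (a \<bullet>\<^sub>J b) \<le> norm a * norm b * K"
    by (rule exI[of _ 1]) (simp add: norm_jprod_le)
qed

lemmas jprod_simps = jprod.add_left jprod.add_right jprod.diff_left jprod.diff_right
  jprod.minus_left jprod.minus_right jprod.scaleR_left jprod.scaleR_right
  jprod.zero_left jprod.zero_right

lemma jprod_unit_right [simp]: "a \<bullet>\<^sub>J \<one>\<^sub>J = a"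
  by (metis jprod_commute jprod_unit_left)

declare jprod_unit_left [simp]

lemma jordan_identity_linearized1:
  "2 *\<^sub>R (a \<bullet>\<^sub>J (b \<bullet>\<^sub>J (a \<bullet>\<^sub>J c))) + c \<bullet>\<^sub>J (b \<bullet>\<^sub>J (a \<bullet>\<^sub>J a))
   = (c \<bullet>\<^sub>J b) \<bullet>\<^sub>J (a \<bullet>\<^sub>J a) + 2 *\<^sub>R ((a \<bullet>\<^sub>J b) \<bullet>\<^sub>J (a \<bullet>\<^sub>J c))"
proof -
  define F where "F a = a \<bullet>\<^sub>J (b \<bullet>\<^sub>J (a \<bullet>\<^sub>J a)) - (a \<bullet>\<^sub>J b) \<bullet>\<^sub>J (a \<bullet>\<^sub>J a)" for a
  have F0: "F a = 0" for a by (simp add: F_def jordan_identity)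
  have ca: "c \<bullet>\<^sub>J a = a \<bullet>\<^sub>J c" by (rule jprod_commute)
  \<comment> \<open>\<open>F\<close> is a cubic form: the difference keeps the terms that are odd in
    \<open>c\<close>, and removing the cubic term \<open>F c\<close> leaves twice the part linear in
    \<open>c\<close>.\<close>
  have "F (a + c) - F (a - c) - 2 *\<^sub>R F c = 2 *\<^sub>R
     ((2 *\<^sub>R (a \<bullet>\<^sub>J (b \<bullet>\<^sub>J (a \<bullet>\<^sub>J c))) + c \<bullet>\<^sub>J (b \<bullet>\<^sub>J (a \<bullet>\<^sub>J a)))
   - ((c \<bullet>\<^sub>J b) \<bullet>\<^sub>J (a \<bullet>\<^sub>J a) + 2 *\<^sub>R ((a \<bullet>\<^sub>J b) \<bullet>\<^sub>J (a \<bullet>\<^sub>J c))))"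
    unfolding F_def by (simp add: jprod_simps ca scaleR_2 algebra_simps)
  then show ?thesis by (simp add: F0)
qed

lemma jordan_identity_linearized:
  "a \<bullet>\<^sub>J (b \<bullet>\<^sub>J (c \<bullet>\<^sub>J d)) + d \<bullet>\<^sub>J (b \<bullet>\<^sub>J (a \<bullet>\<^sub>J c)) + c \<bullet>\<^sub>J (b \<bullet>\<^sub>J (a \<bullet>\<^sub>J d))
   = (c \<bullet>\<^sub>J b) \<bullet>\<^sub>J (a \<bullet>\<^sub>J d) + (a \<bullet>\<^sub>J b) \<bullet>\<^sub>J (c \<bullet>\<^sub>J d) + (d \<bullet>\<^sub>J b) \<bullet>\<^sub>J (a \<bullet>\<^sub>J c)"
proof -
  define G where "G a = (2 *\<^sub>R (a \<bullet>\<^sub>J (b \<bullet>\<^sub>J (a \<bullet>\<^sub>J c))) + c \<bullet>\<^sub>J (b \<bullet>\<^sub>J (a \<bullet>\<^sub>J a)))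
   - ((c \<bullet>\<^sub>J b) \<bullet>\<^sub>J (a \<bullet>\<^sub>J a) + 2 *\<^sub>R ((a \<bullet>\<^sub>J b) \<bullet>\<^sub>J (a \<bullet>\<^sub>J c)))" for a
  have G0: "G a = 0" for a by (simp add: G_def jordan_identity_linearized1)
  have ca: "d \<bullet>\<^sub>J a = a \<bullet>\<^sub>J d" "d \<bullet>\<^sub>J c = c \<bullet>\<^sub>J d" by (rule jprod_commute)+
  \<comment> \<open>\<open>G\<close> is a quadratic form, so this is its polar form.\<close>
  have "G (a + d) - G a - G d = 2 *\<^sub>R
     ((a \<bullet>\<^sub>J (b \<bullet>\<^sub>J (c \<bullet>\<^sub>J d)) + d \<bullet>\<^sub>J (b \<bullet>\<^sub>J (a \<bullet>\<^sub>J c)) + c \<bullet>\<^sub>J (b \<bullet>\<^sub>J (a \<bullet>\<^sub>J d)))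
   - ((c \<bullet>\<^sub>J b) \<bullet>\<^sub>J (a \<bullet>\<^sub>J d) + (a \<bullet>\<^sub>J b) \<bullet>\<^sub>J (c \<bullet>\<^sub>J d) + (d \<bullet>\<^sub>J b) \<bullet>\<^sub>J (a \<bullet>\<^sub>J c)))"
    unfolding G_def by (simp add: jprod_simps ca scaleR_2 algebra_simps)
  then show ?thesis by (simp add: G0)
qed

text \<open>As an identity of operators acting on \<open>w\<close>: multiplication by x(yz) is a
  polynomial in the multiplications by x, y, z and by their pairwise products. With
  \<open>x = y = a\<close> it becomes a recursion that reduces multiplication by any power of
  \<open>a\<close> to multiplication by \<open>a\<close> and by a^2.\<close>

lemma jprod_triple:
  "(x \<bullet>\<^sub>J (y \<bullet>\<^sub>J z)) \<bullet>\<^sub>J w = (x \<bullet>\<^sub>J y) \<bullet>\<^sub>J (z \<bullet>\<^sub>J w) + (x \<bullet>\<^sub>J z) \<bullet>\<^sub>J (y \<bullet>\<^sub>J w) + (y \<bullet>\<^sub>J z) \<bullet>\<^sub>J (x \<bullet>\<^sub>J w)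
     - y \<bullet>\<^sub>J (x \<bullet>\<^sub>J (z \<bullet>\<^sub>J w)) - z \<bullet>\<^sub>J (x \<bullet>\<^sub>J (y \<bullet>\<^sub>J w))"
  using jordan_identity_linearized[of w x y z]
  by (simp add: algebra_simps jprod_commute)

section \<open>Polynomials in one element\<close>

definition jpoly :: "real poly \<Rightarrow> 'a::jb_algebra \<Rightarrow> 'a" where
  "jpoly p a = fold_coeffs (\<lambda>c x. c *\<^sub>R \<one>\<^sub>J + a \<bullet>\<^sub>J x) p 0"

lemma jpoly_0 [simp]: "jpoly 0 a = 0"
  by (simp add: jpoly_def)

lemma jpoly_pCons [simp]: "jpoly (pCons c p) a = c *\<^sub>R \<one>\<^sub>J + a \<bullet>\<^sub>J jpoly p a"
  by (cases "p = 0 \<and> c = 0") (auto simp: jpoly_def jprod.zero_right)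

lemma jpoly_1 [simp]: "jpoly 1 a = \<one>\<^sub>J"
  by (simp add: one_pCons jprod.zero_right)

lemma jpoly_add [simp]: "jpoly (p + q) a = jpoly p a + jpoly q a"
  by (induction p q rule: poly_induct2) (simp_all add: jprod_simps algebra_simps)

lemma jpoly_smult [simp]: "jpoly (smult r p) a = r *\<^sub>R jpoly p a"
  by (induction p) (simp_all add: jprod_simps algebra_simps)

lemma jpoly_minus [simp]: "jpoly (- p) a = - jpoly p a"
  by (induction p) (simp_all add: jprod_simps)

lemma jpoly_diff [simp]: "jpoly (p - q) a = jpoly p a - jpoly q a"
  by (metis diff_conv_add_uminus jpoly_add jpoly_minus)

text \<open>The recursion from \<open>jprod_triple\<close> expresses multiplication by a polynomial
  in \<open>a\<close> through multiplication by \<open>a\<close> and a^2. The induction carries a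
  second claim because \<open>jprod_triple\<close> at \<open>a\<close>, \<open>a\<close>,
  \<open>jpoly p a\<close> also produces the factor
  \<open>a \<bullet>\<^sub>J jpoly p a\<close>.\<close>

lemma jpoly_operator_commute_gen:
  assumes "linear S"
    and Sa: "\<And>z. S (a \<bullet>\<^sub>J z) = a \<bullet>\<^sub>J S z"
    and Saa: "\<And>z. S ((a \<bullet>\<^sub>J a) \<bullet>\<^sub>J z) = (a \<bullet>\<^sub>J a) \<bullet>\<^sub>J S z"
  shows "S (jpoly p a \<bullet>\<^sub>J z) = jpoly p a \<bullet>\<^sub>J S z"
proof -
  interpret linear S by fact
  have "(\<forall>z. S (jpoly p a \<bullet>\<^sub>J z) = jpoly p a \<bullet>\<^sub>J S z) \<and>
        (\<forall>z. S ((a \<bullet>\<^sub>J jpoly p a) \<bullet>\<^sub>J z) = (a \<bullet>\<^sub>J jpoly p a) \<bullet>\<^sub>J S z)"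
  proof (induction p)
    case 0
    then show ?case by (simp add: jprod_simps zero)
  next
    case (pCons c p)
    then show ?case
      by (simp add: jprod_simps add scale diff jprod_triple Sa Saa)
  qed
  then show ?thesis by blast
qed

lemma linear_jprod: "linear ((\<bullet>\<^sub>J) (x::'a::jb_algebra))"
  by (rule linearI) (simp_all add: jprod_simps)

text \<open>The Jordan identity is the commutation of the multiplications by \<open>a\<close> and by
  a^2. The preceding lemma spreads it to all polynomials, once on each side.\<close>

lemma jpoly_operator_commute:
  "jpoly p a \<bullet>\<^sub>J (jpoly q a \<bullet>\<^sub>J z) = jpoly q a \<bullet>\<^sub>J (jpoly p a \<bullet>\<^sub>J z)"
proof -
  have aaa: "a \<bullet>\<^sub>J ((a \<bullet>\<^sub>J a) \<bullet>\<^sub>J z) = (a \<bullet>\<^sub>J a) \<bullet>\<^sub>J (a \<bullet>\<^sub>J z)" for z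
    using jordan_identity[of a z] by (simp add: jprod_commute)
  have 1: "a \<bullet>\<^sub>J (jpoly p a \<bullet>\<^sub>J z) = jpoly p a \<bullet>\<^sub>J (a \<bullet>\<^sub>J z)" for p z
    by (rule jpoly_operator_commute_gen[OF linear_jprod]) (simp_all add: aaa)
  have 2: "(a \<bullet>\<^sub>J a) \<bullet>\<^sub>J (jpoly p a \<bullet>\<^sub>J z) = jpoly p a \<bullet>\<^sub>J ((a \<bullet>\<^sub>J a) \<bullet>\<^sub>J z)" for p z
    by (rule jpoly_operator_commute_gen[OF linear_jprod]) (simp_all add: aaa)
  show ?thesis
    by (rule jpoly_operator_commute_gen[OF linear_jprod]) (simp_all add: 1 2)
qed

lemma jpoly_mult [simp]: "jpoly (p * q) a = jpoly p a \<bullet>\<^sub>J jpoly q a"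
proof (induction p)
  case (pCons c p)
  have "a \<bullet>\<^sub>J (jpoly p a \<bullet>\<^sub>J jpoly q a) = (a \<bullet>\<^sub>J jpoly p a) \<bullet>\<^sub>J jpoly q a"
    using jpoly_operator_commute[of "[:0,1:]" a q "jpoly p a"]
    by (simp add: jprod_commute jprod_simps)
  with pCons show ?case by (simp add: jprod_simps)
qed (simp add: jprod_simps)

section \<open>The closed associative subalgebra generated by one element\<close>

definition jb_gen :: "'a::jb_algebra \<Rightarrow> 'a set" where
  "jb_gen a = closure (range (\<lambda>p. jpoly p a))"

lemma jpoly_in_jb_gen [intro, simp]: "jpoly p a \<in> jb_gen a"
  unfolding jb_gen_def by (meson closure_subset rangeI subsetD)

lemma jb_gen_seqE:
  assumes "x \<in> jb_gen a"
  obtains P where "(\<lambda>n. jpoly (P n) a) \<longlonglongrightarrow> x"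
proof -
  obtain X where X: "\<forall>n. X n \<in> range (\<lambda>p. jpoly p a)" "X \<longlonglongrightarrow> x"
    using assms unfolding jb_gen_def closure_sequential by blast
  then have "\<forall>n. \<exists>p. X n = jpoly p a" by blast
  then obtain P where "X = (\<lambda>n. jpoly (P n) a)" by (metis ext)
  with X that show ?thesis by blast
qed

lemma jb_gen_limit:
  assumes "(\<lambda>n. X n) \<longlonglongrightarrow> x" "\<And>n. X n \<in> jb_gen a"
  shows "x \<in> jb_gen a"
  using assms closed_sequentially closed_closure unfolding jb_gen_def by blast

lemma jb_gen_self [intro, simp]: "a \<in> jb_gen a"
  using jpoly_in_jb_gen[of "[:0,1:]" a] by (simp add: jprod_simps)

lemma jb_gen_unit [intro, simp]: "\<one>\<^sub>J \<in> jb_gen a"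
  using jpoly_in_jb_gen[of 1 a] by simp

lemma jb_gen_add [intro, simp]:
  assumes "x \<in> jb_gen a" "y \<in> jb_gen a"
  shows "x + y \<in> jb_gen a"
proof -
  obtain P where P: "(\<lambda>n. jpoly (P n) a) \<longlonglongrightarrow> x" using assms(1) by (rule jb_gen_seqE)
  obtain Q where Q: "(\<lambda>n. jpoly (Q n) a) \<longlonglongrightarrow> y" using assms(2) by (rule jb_gen_seqE)
  show ?thesis
    using jb_gen_limit[OF tendsto_add[OF P Q]] by (simp flip: jpoly_add)
qed

lemma jb_gen_scaleR [intro, simp]:
  assumes "x \<in> jb_gen a"
  shows "r *\<^sub>R x \<in> jb_gen a"
proof -
  obtain P where P: "(\<lambda>n. jpoly (P n) a) \<longlonglongrightarrow> x" using assms(1) by (rule jb_gen_seqE)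
  show ?thesis
    using jb_gen_limit[OF tendsto_scaleR[OF tendsto_const P]] by (simp flip: jpoly_smult)
qed

lemma jb_gen_diff [intro, simp]:
  assumes "x \<in> jb_gen a" "y \<in> jb_gen a"
  shows "x - y \<in> jb_gen a"
  using jb_gen_add[OF assms(1) jb_gen_scaleR[OF assms(2), of "-1"]] by simp

lemma jb_gen_0 [intro, simp]: "0 \<in> jb_gen a"
  using jpoly_in_jb_gen[of 0 a] by simp

lemma jb_gen_prod [intro, simp]:
  assumes "x \<in> jb_gen a" "y \<in> jb_gen a"
  shows "x \<bullet>\<^sub>J y \<in> jb_gen a"
proof -
  obtain P where P: "(\<lambda>n. jpoly (P n) a) \<longlonglongrightarrow> x" using assms(1) by (rule jb_gen_seqE)
  obtain Q where Q: "(\<lambda>n. jpoly (Q n) a) \<longlonglongrightarrow> y" using assms(2) by (rule jb_gen_seqE)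
  show ?thesis
    using jb_gen_limit[OF jprod.tendsto[OF P Q]] by (simp flip: jpoly_mult)
qed

text \<open>Here \<open>z\<close> ranges over the whole algebra. Associativity of
  \<open>jb_gen a\<close> is the special case in which \<open>z\<close> lies in it as well; the
  general form is what \<open>quad_rep_mult\<close> needs.\<close>

lemma jb_gen_operator_commute:
  assumes "x \<in> jb_gen a" "y \<in> jb_gen a"
  shows "x \<bullet>\<^sub>J (y \<bullet>\<^sub>J z) = y \<bullet>\<^sub>J (x \<bullet>\<^sub>J z)"
proof -
  obtain P where P: "(\<lambda>n. jpoly (P n) a) \<longlonglongrightarrow> x" using assms(1) by (rule jb_gen_seqE)
  obtain Q where Q: "(\<lambda>n. jpoly (Q n) a) \<longlonglongrightarrow> y" using assms(2) by (rule jb_gen_seqE)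
  have 1: "(\<lambda>n. jpoly (P n) a \<bullet>\<^sub>J (jpoly (Q n) a \<bullet>\<^sub>J z)) \<longlonglongrightarrow> x \<bullet>\<^sub>J (y \<bullet>\<^sub>J z)"
    by (intro jprod.tendsto P Q tendsto_const)
  have 2: "(\<lambda>n. jpoly (Q n) a \<bullet>\<^sub>J (jpoly (P n) a \<bullet>\<^sub>J z)) \<longlonglongrightarrow> y \<bullet>\<^sub>J (x \<bullet>\<^sub>J z)"
    by (intro jprod.tendsto P Q tendsto_const)
  show ?thesis
    using LIMSEQ_unique[OF 1] 2 by (simp add: jpoly_operator_commute[of "P _" a "Q _"])
qed

lemma jb_gen_assoc:
  assumes "x \<in> jb_gen a" "y \<in> jb_gen a" "z \<in> jb_gen a"
  shows "(x \<bullet>\<^sub>J y) \<bullet>\<^sub>J z = x \<bullet>\<^sub>J (y \<bullet>\<^sub>J z)"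
  by (metis assms jb_gen_operator_commute jprod_commute)

section \<open>Square roots, the order and invertibility\<close>

text \<open>The zero space satisfies all axioms, and there the unit has norm 0; a nonzero element
  excludes this case.\<close>

lemma norm_jb_unit:
  assumes "(x::'a::jb_algebra) \<noteq> 0"
  shows "norm (\<one>\<^sub>J :: 'a) = 1"
proof -
  have "norm (\<one>\<^sub>J :: 'a) ^ 2 = norm (\<one>\<^sub>J :: 'a)"
    using norm_jsquare[of "\<one>\<^sub>J :: 'a"] by simp
  moreover have "norm (\<one>\<^sub>J :: 'a) \<noteq> 0"
    by (metis assms jprod_unit_left jprod.zero_left norm_eq_zero)
  ultimately show ?thesis by (simp add: power2_eq_square)
qed

lemma norm_jb_unit_le: "norm (\<one>\<^sub>J :: 'a::jb_algebra) \<le> 1"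
  by (cases "(\<one>\<^sub>J :: 'a) = 0") (simp_all add: norm_jb_unit)

text \<open>With \<open>e - x = (e - y)\<^sup>2\<close> the equation for \<open>y\<close> reads \<open>y = (x + y\<^sup>2) / 2\<close>. The iteration converges
  even for \<open>norm x = 1\<close>, since its increments are dominated by those of the scalar iteration
  for \<open>x = 1\<close>, which increases to \<open>1\<close>.\<close>

lemma unit_minus_is_square:
  assumes "x \<in> jb_gen a" "norm x \<le> 1"
  shows "\<exists>w\<in>jb_gen a. \<one>\<^sub>J - x = w \<bullet>\<^sub>J w"
proof -
  define y where "y = rec_nat 0 (\<lambda>_ z. (1/2) *\<^sub>R (x + z \<bullet>\<^sub>J z))"
  have y0: "y 0 = 0" and yS: "\<And>n. y (Suc n) = (1/2) *\<^sub>R (x + y n \<bullet>\<^sub>J y n)"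
    by (simp_all add: y_def)
  define s :: "nat \<Rightarrow> real" where "s = rec_nat 0 (\<lambda>_ z. (1 + z\<^sup>2) / 2)"
  have s0: "s 0 = 0" and sS: "\<And>n. s (Suc n) = (1 + (s n)\<^sup>2) / 2"
    by (simp_all add: s_def)
  have s_bounds: "0 \<le> s n \<and> s n \<le> 1" for n
    by (induction n) (auto simp: s0 sS power_le_one)
  have s_inc: "s n \<le> s (Suc n)" for n
    using zero_le_power2[of "1 - s n"] by (simp add: sS power2_eq_square algebra_simps)
  have y_gen: "y n \<in> jb_gen a" for n
    by (induction n) (auto simp: y0 yS assms)
  have y_norm: "norm (y n) \<le> s n" for n
  proof (induction n)
    case (Suc n)
    have "norm (x + y n \<bullet>\<^sub>J y n) \<le> norm x + norm (y n \<bullet>\<^sub>J y n)" by (rule norm_triangle_ineq)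
    also have "\<dots> \<le> 1 + (s n)\<^sup>2"
      using assms(2) power_mono[OF Suc, of 2] by (simp add: norm_jsquare)
    finally show ?case by (simp add: yS sS)
  qed (simp add: y0 s0)
  have y_inc: "norm (y (Suc n) - y n) \<le> s (Suc n) - s n" for n
  proof (induction n)
    case 0
    show ?case using y_norm[of 1] by (simp add: y0 s0)
  next
    case (Suc n)
    have "y (Suc (Suc n)) - y (Suc n) = (1/2) *\<^sub>R ((y (Suc n) - y n) \<bullet>\<^sub>J (y (Suc n) + y n))"
      unfolding yS[of "Suc n"] yS[of n, THEN arg_cong, of "\<lambda>u. z - u" for z]
      by (simp add: jprod_simps algebra_simps jprod_commute)
    then have "norm (y (Suc (Suc n)) - y (Suc n)) =
        norm ((y (Suc n) - y n) \<bullet>\<^sub>J (y (Suc n) + y n)) / 2" by simp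
    also have "\<dots> \<le> norm (y (Suc n) - y n) * norm (y (Suc n) + y n) / 2"
      by (simp add: norm_jprod_le)
    also have "\<dots> \<le> (s (Suc n) - s n) * (s (Suc n) + s n) / 2"
      using norm_triangle_mono[OF y_norm[of "Suc n"] y_norm[of n]] s_inc[of n]
      by (intro divide_right_mono mult_mono Suc) auto
    also have "\<dots> = s (Suc (Suc n)) - s (Suc n)"
      unfolding sS[of "Suc n"] sS[of n, THEN arg_cong, of "\<lambda>u. z - u" for z]
      by (simp add: power2_eq_square field_simps)
    finally show ?case .
  qed
  have "convergent s"
    by (rule Bseq_monoseq_convergent)
       (use s_bounds s_inc in \<open>auto simp: Bseq_def monoseq_Suc intro!: exI[of _ 1]\<close>)
  then obtain l where l: "s \<longlonglongrightarrow> l" by (auto simp: convergent_def)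
  have "summable (\<lambda>n. y (Suc n) - y n)"
    by (rule summable_comparison_test'[OF telescope_summable[OF l], of 0])
       (use y_inc in auto)
  then have "convergent (\<lambda>n. \<Sum>i<n. y (Suc i) - y i)" by (simp add: summable_iff_convergent)
  then have "convergent y" by (simp add: sum_lessThan_telescope y0)
  then obtain Y where Y: "y \<longlonglongrightarrow> Y" by (auto simp: convergent_def)
  have "(\<lambda>n. y (Suc n)) \<longlonglongrightarrow> (1/2) *\<^sub>R (x + Y \<bullet>\<^sub>J Y)"
    unfolding yS by (intro tendsto_intros jprod.tendsto Y)
  with LIMSEQ_Suc[OF Y] have "Y = (1/2) *\<^sub>R (x + Y \<bullet>\<^sub>J Y)" using LIMSEQ_unique by blast
  then have "2 *\<^sub>R Y = 2 *\<^sub>R ((1/2) *\<^sub>R (x + Y \<bullet>\<^sub>J Y))" by (rule arg_cong)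
  then have "2 *\<^sub>R Y = x + Y \<bullet>\<^sub>J Y" by simp
  then have "\<one>\<^sub>J - x = (\<one>\<^sub>J - Y) \<bullet>\<^sub>J (\<one>\<^sub>J - Y)"
    by (simp add: jprod_simps scaleR_2 algebra_simps)
  moreover have "\<one>\<^sub>J - Y \<in> jb_gen a" using jb_gen_limit[OF Y y_gen] by auto
  ultimately show ?thesis by blast
qed

lemma square_root_of_near_unit:
  assumes "y \<in> jb_gen a" "norm (\<alpha> *\<^sub>R \<one>\<^sub>J - y) \<le> \<alpha>"
  shows "\<exists>w\<in>jb_gen a. y = w \<bullet>\<^sub>J w"
proof (cases "\<alpha> = 0")
  case True
  then show ?thesis using assms(2) by (intro bexI[of _ 0]) (auto simp: jprod_simps)
next
  case False
  then have \<alpha>: "\<alpha> > 0" using order_trans[OF norm_ge_zero assms(2)] by simp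
  have eq: "\<one>\<^sub>J - (1/\<alpha>) *\<^sub>R y = (1/\<alpha>) *\<^sub>R (\<alpha> *\<^sub>R \<one>\<^sub>J - y)" using \<alpha> by (simp add: scaleR_diff_right)
  have "norm (\<one>\<^sub>J - (1/\<alpha>) *\<^sub>R y) \<le> 1"
    unfolding eq using assms(2) \<alpha> by simp
  with unit_minus_is_square[of "\<one>\<^sub>J - (1/\<alpha>) *\<^sub>R y" a] assms(1)
  obtain w where w: "w \<in> jb_gen a" "(1/\<alpha>) *\<^sub>R y = w \<bullet>\<^sub>J w" by auto
  have "y = \<alpha> *\<^sub>R ((1/\<alpha>) *\<^sub>R y)" using \<alpha> by simp
  also have "\<dots> = (sqrt \<alpha> *\<^sub>R w) \<bullet>\<^sub>J (sqrt \<alpha> *\<^sub>R w)" using \<alpha> by (simp add: w(2) jprod_simps)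
  finally show ?thesis using w(1) by blast
qed

section \<open>The cone and its order\<close>

lemma in_jb_cone_iff: "x \<in> jb_cone \<longleftrightarrow> (\<exists>z. x = z \<bullet>\<^sub>J z)"
  by (auto simp: jb_cone_def)

lemma jb_cone_square [intro, simp]: "z \<bullet>\<^sub>J z \<in> jb_cone"
  by (auto simp: in_jb_cone_iff)

text \<open>After scaling to norm at most 1, both \<open>y\<close> and e - y are squares, and they
  add up to e; the axiom \<open>norm_jsquare_le\<close> then bounds e - y by e. Together with
  \<open>jb_coneI\<close> this describes the cone by norms, which yields convexity and
  closedness.\<close>

lemma jb_cone_norm_bound:
  fixes y :: "'a::jb_algebra"
  assumes "y \<in> jb_cone" "norm y \<le> \<alpha>"
  shows "norm (\<alpha> *\<^sub>R \<one>\<^sub>J - y) \<le> \<alpha>"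
proof (cases "\<alpha> = 0")
  case True
  then show ?thesis using assms(2) by auto
next
  case False
  then have \<alpha>: "\<alpha> > 0" using order_trans[OF norm_ge_zero assms(2)] by simp
  obtain z where z: "y = z \<bullet>\<^sub>J z" using assms(1) by (auto simp: in_jb_cone_iff)
  have "norm ((1/\<alpha>) *\<^sub>R y) \<le> 1" using assms(2) \<alpha> by (simp add: field_simps)
  then obtain w where w: "\<one>\<^sub>J - (1/\<alpha>) *\<^sub>R y = w \<bullet>\<^sub>J w"
    using unit_minus_is_square[OF jb_gen_self] by blast
  define v where "v = (1 / sqrt \<alpha>) *\<^sub>R z"
  have "v \<bullet>\<^sub>J v = (1/\<alpha>) *\<^sub>R y" using \<alpha> by (simp add: v_def jprod_simps z)
  then have "w \<bullet>\<^sub>J w + v \<bullet>\<^sub>J v = \<one>\<^sub>J" by (simp flip: w)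
  then have "norm (\<one>\<^sub>J - (1/\<alpha>) *\<^sub>R y) \<le> 1"
    using norm_jsquare_le[of w v] norm_jb_unit_le[where 'a='a] by (simp add: w)
  then have "\<alpha> * norm (\<one>\<^sub>J - (1/\<alpha>) *\<^sub>R y) \<le> \<alpha>" using \<alpha> by simp
  moreover have "\<alpha> *\<^sub>R \<one>\<^sub>J - y = \<alpha> *\<^sub>R (\<one>\<^sub>J - (1/\<alpha>) *\<^sub>R y)" using \<alpha> by (simp add: scaleR_diff_right)
  ultimately show ?thesis using \<alpha> by simp
qed

lemma jb_coneI: "norm (\<alpha> *\<^sub>R \<one>\<^sub>J - y) \<le> \<alpha> \<Longrightarrow> y \<in> jb_cone"
  using square_root_of_near_unit[OF jb_gen_self] by (auto simp: in_jb_cone_iff)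

text \<open>The root can be taken inside any \<open>jb_gen a\<close> that contains \<open>y\<close>.
  This is what makes products of positive elements of one such subalgebra positive.\<close>

lemma jb_cone_sqrt:
  assumes "y \<in> jb_cone" "y \<in> jb_gen a"
  obtains w where "w \<in> jb_gen a" "y = w \<bullet>\<^sub>J w"
  using square_root_of_near_unit[OF assms(2) jb_cone_norm_bound[OF assms(1) order_refl]] by blast

lemma jb_cone_0 [simp, intro]: "0 \<in> jb_cone"
  using jb_cone_square[of 0] by (simp add: jprod_simps)

lemma jb_cone_unit [simp, intro]: "\<one>\<^sub>J \<in> jb_cone"
  using jb_cone_square[of "\<one>\<^sub>J"] by simp

lemma jb_cone_add [intro]:
  assumes "x \<in> jb_cone" "y \<in> jb_cone"
  shows "x + y \<in> jb_cone"
proof (rule jb_coneI)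
  have "(norm x + norm y) *\<^sub>R \<one>\<^sub>J - (x + y) = (norm x *\<^sub>R \<one>\<^sub>J - x) + (norm y *\<^sub>R \<one>\<^sub>J - y)"
    by (simp add: algebra_simps)
  also have "norm \<dots> \<le> norm x + norm y"
    by (intro norm_triangle_mono jb_cone_norm_bound assms order_refl)
  finally show "norm ((norm x + norm y) *\<^sub>R \<one>\<^sub>J - (x + y)) \<le> norm x + norm y" .
qed

lemma jb_cone_scaleR [intro]:
  assumes "x \<in> jb_cone" "r \<ge> 0"
  shows "r *\<^sub>R x \<in> jb_cone"
proof -
  obtain z where "x = z \<bullet>\<^sub>J z" using assms by (auto simp: in_jb_cone_iff)
  then have "r *\<^sub>R x = (sqrt r *\<^sub>R z) \<bullet>\<^sub>J (sqrt r *\<^sub>R z)" using assms by (simp add: jprod_simps)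
  then show ?thesis by (auto simp: in_jb_cone_iff)
qed

lemma closed_jb_cone: "closed (jb_cone :: 'a::jb_algebra set)"
proof -
  have "(jb_cone :: 'a set) = {y. norm (norm y *\<^sub>R \<one>\<^sub>J - y) \<le> norm y}"
    using jb_cone_norm_bound jb_coneI by blast
  moreover have "closed {y :: 'a. norm (norm y *\<^sub>R \<one>\<^sub>J - y) \<le> norm y}"
    by (intro closed_Collect_le continuous_intros)
  ultimately show ?thesis by simp
qed

lemma jb_cone_proper:
  assumes "x \<in> jb_cone" "- x \<in> jb_cone"
  shows "x = 0"
proof -
  obtain z w where zw: "x = z \<bullet>\<^sub>J z" "- x = w \<bullet>\<^sub>J w" using assms by (auto simp: in_jb_cone_iff)
  then have "z \<bullet>\<^sub>J z + w \<bullet>\<^sub>J w = 0" by (simp flip: zw)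
  with norm_jsquare_le[of z w] zw show ?thesis by simp
qed

lemma jb_le_refl [simp, intro]: "x \<le>\<^sub>J x"
  by (simp add: jb_le_def)

lemma jb_le_trans [trans]: "x \<le>\<^sub>J y \<Longrightarrow> y \<le>\<^sub>J z \<Longrightarrow> x \<le>\<^sub>J z"
  unfolding jb_le_def using jb_cone_add[of "y - x" "z - y"] by simp

lemma jb_le_antisym: "x \<le>\<^sub>J y \<Longrightarrow> y \<le>\<^sub>J x \<Longrightarrow> x = y"
  unfolding jb_le_def using jb_cone_proper[of "y - x"] by simp

lemma jb_le_add_mono: "x \<le>\<^sub>J y \<Longrightarrow> z \<le>\<^sub>J w \<Longrightarrow> x + z \<le>\<^sub>J y + w"
  unfolding jb_le_def using jb_cone_add[of "y - x" "w - z"] by (simp add: algebra_simps)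

lemma jb_le_scaleR_mono: "x \<le>\<^sub>J y \<Longrightarrow> r \<ge> 0 \<Longrightarrow> r *\<^sub>R x \<le>\<^sub>J r *\<^sub>R y"
  unfolding jb_le_def using jb_cone_scaleR[of "y - x" r] by (simp add: algebra_simps)

lemma jb_le_scaleR_left: "0 \<le>\<^sub>J x \<Longrightarrow> r \<le> s \<Longrightarrow> r *\<^sub>R x \<le>\<^sub>J s *\<^sub>R x"
  unfolding jb_le_def using jb_cone_scaleR[of x "s - r"] by (simp add: algebra_simps)

lemma jb_le_unit_mono: "r \<le> s \<Longrightarrow> r *\<^sub>R \<one>\<^sub>J \<le>\<^sub>J s *\<^sub>R \<one>\<^sub>J"
  by (rule jb_le_scaleR_left) (simp_all add: jb_le_def)

lemma jb_nonneg_iff: "0 \<le>\<^sub>J x \<longleftrightarrow> x \<in> jb_cone"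
  by (simp add: jb_le_def)

lemma jb_le_limit:
  assumes "X \<longlonglongrightarrow> x" "Y \<longlonglongrightarrow> y" "\<forall>\<^sub>F n in sequentially. X n \<le>\<^sub>J Y n"
  shows "x \<le>\<^sub>J y"
  using Lim_in_closed_set[OF closed_jb_cone _ _ tendsto_diff[OF assms(2,1)]] assms(3)
  by (simp add: jb_le_def)

lemma jb_le_norm: "x \<le>\<^sub>J norm x *\<^sub>R \<one>\<^sub>J"
  unfolding jb_le_def by (rule jb_coneI[of "norm x"]) simp

lemma neg_norm_jb_le: "- (norm x *\<^sub>R \<one>\<^sub>J) \<le>\<^sub>J x"
  unfolding jb_le_def by (rule jb_coneI[of "norm x"]) simp

text \<open>In an associative commutative subalgebra a product of squares is the square of the
  product. Without a common generator the claim fails already for symmetric matrices.\<close>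

lemma jb_cone_prod:
  assumes "x \<in> jb_cone" "y \<in> jb_cone" "x \<in> jb_gen a" "y \<in> jb_gen a"
  shows "x \<bullet>\<^sub>J y \<in> jb_cone"
proof -
  obtain u where u: "u \<in> jb_gen a" "x = u \<bullet>\<^sub>J u" using assms by (rule_tac jb_cone_sqrt)
  obtain v where v: "v \<in> jb_gen a" "y = v \<bullet>\<^sub>J v" using assms by (rule_tac jb_cone_sqrt)
  have "x \<bullet>\<^sub>J y = (u \<bullet>\<^sub>J v) \<bullet>\<^sub>J (u \<bullet>\<^sub>J v)"
    using u v by (simp add: jb_gen_assoc[of _ a] jb_gen_operator_commute[of v a u])
  then show ?thesis by (auto simp: in_jb_cone_iff)
qed

text \<open>The product (r e - x)(r e + x) of positive elements of \<open>jb_gen x\<close> is a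
  square, so r^2 e is x^2 plus a square and \<open>norm_jsquare_le\<close> applies.\<close>

lemma norm_le_of_jb_le:
  assumes "- (r *\<^sub>R \<one>\<^sub>J) \<le>\<^sub>J x" "x \<le>\<^sub>J r *\<^sub>R \<one>\<^sub>J" "r \<ge> 0"
  shows "norm (x::'a::jb_algebra) \<le> r"
proof -
  have "(r *\<^sub>R \<one>\<^sub>J - x) \<bullet>\<^sub>J (x + r *\<^sub>R \<one>\<^sub>J) \<in> jb_cone"
    by (rule jb_cone_prod[of _ _ x]) (use assms in \<open>auto simp: jb_le_def\<close>)
  then obtain w where w: "r\<^sup>2 *\<^sub>R \<one>\<^sub>J - x \<bullet>\<^sub>J x = w \<bullet>\<^sub>J w"
    by (auto simp: in_jb_cone_iff jprod_simps algebra_simps power2_eq_square)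
  have "x \<bullet>\<^sub>J x + w \<bullet>\<^sub>J w = r\<^sup>2 *\<^sub>R \<one>\<^sub>J" by (simp flip: w)
  then have "(norm x)\<^sup>2 \<le> norm (r\<^sup>2 *\<^sub>R (\<one>\<^sub>J::'a))"
    using norm_jsquare_le[of x w] by (simp add: norm_jsquare)
  also have "\<dots> \<le> r\<^sup>2" using mult_left_mono[OF norm_jb_unit_le[where 'a='a], of "r\<^sup>2"] by simp
  finally show ?thesis using assms(3) by (simp add: power2_le_iff_abs_le)
qed

lemma norm_le_of_nonneg_jb_le:
  assumes "x \<in> jb_cone" "x \<le>\<^sub>J r *\<^sub>R \<one>\<^sub>J" "r \<ge> 0"
  shows "norm x \<le> r"
proof (rule norm_le_of_jb_le)
  show "- (r *\<^sub>R \<one>\<^sub>J) \<le>\<^sub>J x"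
    unfolding jb_le_def using assms(1,3) by (simp add: jb_cone_add jb_cone_scaleR)
qed (use assms in auto)

lemma unit_scaleR_jb_le_imp_le:
  fixes x :: "'a::jb_algebra"
  assumes "r *\<^sub>R \<one>\<^sub>J \<le>\<^sub>J s *\<^sub>R (\<one>\<^sub>J::'a)" "x \<noteq> 0"
  shows "r \<le> s"
proof (rule ccontr)
  assume "\<not> r \<le> s"
  then have "s *\<^sub>R \<one>\<^sub>J \<le>\<^sub>J r *\<^sub>R (\<one>\<^sub>J::'a)" by (intro jb_le_unit_mono) simp
  with assms have "r *\<^sub>R \<one>\<^sub>J = s *\<^sub>R (\<one>\<^sub>J::'a)" by (blast intro: jb_le_antisym)
  moreover have "(\<one>\<^sub>J::'a) \<noteq> 0" using norm_jb_unit[OF assms(2)] by auto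
  ultimately show False using \<open>\<not> r \<le> s\<close> by simp
qed

lemma square_jb_le:
  assumes "y \<in> jb_cone" "norm y \<le> B"
  shows "y \<bullet>\<^sub>J y \<le>\<^sub>J B *\<^sub>R y"
proof -
  have "norm y *\<^sub>R \<one>\<^sub>J - y \<in> jb_cone" using jb_le_norm[of y] by (simp add: jb_le_def)
  then have "B *\<^sub>R \<one>\<^sub>J - y \<in> jb_cone"
    using jb_cone_add[OF _ jb_cone_scaleR[OF jb_cone_unit, of "B - norm y"],
        of "norm y *\<^sub>R \<one>\<^sub>J - y"] assms(2)
    by (simp add: scaleR_diff_left)
  then have "y \<bullet>\<^sub>J (B *\<^sub>R \<one>\<^sub>J - y) \<in> jb_cone" by (intro jb_cone_prod[of _ _ y] assms) auto
  then show ?thesis by (simp add: jb_le_def jprod_simps)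
qed

text \<open>The order form of the Cauchy-Schwarz inequality for the form \<open>(u, v) \<mapsto> u \<bullet>\<^sub>J v\<close>: expand a
  square and bound \<open>y \<bullet>\<^sub>J y\<close> by \<open>B *\<^sub>R y\<close>.\<close>

lemma jprod_lower_bound:
  assumes "y \<in> jb_cone" "norm y \<le> B" "B > 0"
  shows "- (B * (norm k)\<^sup>2) *\<^sub>R \<one>\<^sub>J - y \<le>\<^sub>J 2 *\<^sub>R (k \<bullet>\<^sub>J y)"
proof -
  define u where "u = (1 / sqrt B) *\<^sub>R y + sqrt B *\<^sub>R k"
  have uu: "u \<bullet>\<^sub>J u = (1/B) *\<^sub>R (y \<bullet>\<^sub>J y) + 2 *\<^sub>R (k \<bullet>\<^sub>J y) + B *\<^sub>R (k \<bullet>\<^sub>J k)"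
    using assms(3) by (simp add: u_def jprod_simps scaleR_2 jprod_commute[of y k] algebra_simps)
  have 1: "(1/B) *\<^sub>R (B *\<^sub>R y - y \<bullet>\<^sub>J y) \<in> jb_cone"
    using square_jb_le[OF assms(1,2)] assms(3) by (intro jb_cone_scaleR) (auto simp: jb_le_def)
  have 2: "B *\<^sub>R ((norm k)\<^sup>2 *\<^sub>R \<one>\<^sub>J - k \<bullet>\<^sub>J k) \<in> jb_cone"
    using jb_le_norm[of "k \<bullet>\<^sub>J k"] assms(3) by (intro jb_cone_scaleR) (auto simp: jb_le_def norm_jsquare)
  have "2 *\<^sub>R (k \<bullet>\<^sub>J y) - (- (B * (norm k)\<^sup>2) *\<^sub>R \<one>\<^sub>J - y)
     = u \<bullet>\<^sub>J u + (1/B) *\<^sub>R (B *\<^sub>R y - y \<bullet>\<^sub>J y) + B *\<^sub>R ((norm k)\<^sup>2 *\<^sub>R \<one>\<^sub>J - k \<bullet>\<^sub>J k)"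
    using assms(3) by (simp add: uu algebra_simps)
  also have "\<dots> \<in> jb_cone" by (intro jb_cone_add 1 2 jb_cone_square)
  finally show ?thesis by (simp add: jb_le_def)
qed

section \<open>Invertibility as an order condition\<close>

lemma jb_gen_inverse:
  assumes "y \<in> jb_gen a" "\<epsilon> > 0" "\<epsilon> *\<^sub>R \<one>\<^sub>J \<le>\<^sub>J y"
  shows "\<exists>z\<in>jb_gen a. y \<bullet>\<^sub>J z = \<one>\<^sub>J"
proof -
  define \<alpha> where "\<alpha> = norm y + \<epsilon>"
  have \<alpha>: "\<alpha> > 0" "\<epsilon> \<le> \<alpha>" using assms(2) by (auto simp: \<alpha>_def add_nonneg_pos)
  define x where "x = \<one>\<^sub>J - (1/\<alpha>) *\<^sub>R y"
  \<comment> \<open>From \<epsilon> e \<le> y \<le> \<alpha> e follows 0 \<le> x \<le> c e, hence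
    \<open>norm x \<le> c < 1\<close>. The fixed point of z = e + xz is the Neumann series for the
    inverse of e - x; contracting on the complete set \<open>jb_gen a\<close> keeps it in the
    subalgebra.\<close>
  define c where "c = 1 - \<epsilon> / \<alpha>"
  have c: "0 \<le> c" "c < 1" using \<alpha> assms(2) by (auto simp: c_def)
  have "y \<le>\<^sub>J \<alpha> *\<^sub>R \<one>\<^sub>J"
    using jb_le_trans[OF jb_le_norm jb_le_unit_mono[of "norm y" \<alpha>]] assms(2) by (simp add: \<alpha>_def)
  then have "(1/\<alpha>) *\<^sub>R (\<alpha> *\<^sub>R \<one>\<^sub>J - y) \<in> jb_cone"
    using \<alpha> by (intro jb_cone_scaleR) (auto simp: jb_le_def)
  then have x0: "x \<in> jb_cone" using \<alpha> by (simp add: x_def algebra_simps)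
  have "(1/\<alpha>) *\<^sub>R (y - \<epsilon> *\<^sub>R \<one>\<^sub>J) \<in> jb_cone"
    using assms(3) \<alpha> by (intro jb_cone_scaleR) (auto simp: jb_le_def)
  then have x1: "x \<le>\<^sub>J c *\<^sub>R \<one>\<^sub>J" by (simp add: x_def c_def jb_le_def algebra_simps)
  have nx: "norm x \<le> c" by (rule norm_le_of_nonneg_jb_le[OF x0 x1 c(1)])
  have xg: "x \<in> jb_gen a" using assms(1) by (auto simp: x_def)
  have "\<exists>!z\<in>jb_gen a. \<one>\<^sub>J + x \<bullet>\<^sub>J z = z"
  proof (rule Banach_fix[of _ c])
    show "complete (jb_gen a)" by (simp add: complete_eq_closed jb_gen_def)
    show "jb_gen a \<noteq> {}" by auto
    show "(\<lambda>z. \<one>\<^sub>J + x \<bullet>\<^sub>J z) ` jb_gen a \<subseteq> jb_gen a" using xg by auto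
    show "dist (\<one>\<^sub>J + x \<bullet>\<^sub>J z) (\<one>\<^sub>J + x \<bullet>\<^sub>J w) \<le> c * dist z w" if "z \<in> jb_gen a" "w \<in> jb_gen a" for z w
    proof -
      have "dist (\<one>\<^sub>J + x \<bullet>\<^sub>J z) (\<one>\<^sub>J + x \<bullet>\<^sub>J w) = norm (x \<bullet>\<^sub>J (z - w))"
        by (simp add: dist_norm jprod_simps)
      also have "\<dots> \<le> norm x * norm (z - w)" by (rule norm_jprod_le)
      also have "\<dots> \<le> c * norm (z - w)" by (intro mult_right_mono nx) simp
      finally show ?thesis by (simp add: dist_norm)
    qed
  qed (use c in auto)
  then obtain z where z: "z \<in> jb_gen a" "\<one>\<^sub>J + x \<bullet>\<^sub>J z = z" by blast
  have "y \<bullet>\<^sub>J ((1/\<alpha>) *\<^sub>R z) = z - x \<bullet>\<^sub>J z" using \<alpha> by (simp add: x_def jprod_simps)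
  also have "\<dots> = \<one>\<^sub>J" using z(2) by (simp add: algebra_simps)
  finally show ?thesis using z(1) by auto
qed

text \<open>A lower bound for x^2 gives an inverse of x^2 in \<open>jb_gen x\<close>, and
  \<open>x\<close> times it inverts \<open>x\<close>. Conversely an inverse \<open>b\<close>,
  wherever it lies, bounds multiplication by \<open>x\<close> from below on \<open>jb_gen x\<close>;
  this bounds the inverse of x^2 + \<delta> e, and bounding an inverse from above bounds the element
  from below.\<close>

lemma jb_invertible_iff: "jb_invertible (x::'a::jb_algebra) \<longleftrightarrow> (\<exists>\<epsilon>>0. \<epsilon> *\<^sub>R \<one>\<^sub>J \<le>\<^sub>J x \<bullet>\<^sub>J x)"
proof
  assume "\<exists>\<epsilon>>0. \<epsilon> *\<^sub>R \<one>\<^sub>J \<le>\<^sub>J x \<bullet>\<^sub>J x"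
  then obtain z where z: "z \<in> jb_gen x" "(x \<bullet>\<^sub>J x) \<bullet>\<^sub>J z = \<one>\<^sub>J"
    using jb_gen_inverse[of "x \<bullet>\<^sub>J x" x] by auto
  then have "x \<bullet>\<^sub>J (x \<bullet>\<^sub>J z) = \<one>\<^sub>J" by (simp add: jb_gen_assoc[of _ x])
  moreover have "(x \<bullet>\<^sub>J x) \<bullet>\<^sub>J (x \<bullet>\<^sub>J z) = x"
    using z by (simp add: jb_gen_operator_commute[of "x \<bullet>\<^sub>J x" x x])
  ultimately show "jb_invertible x" unfolding jb_invertible_def by blast
next
  assume "jb_invertible x"
  then obtain b where b: "x \<bullet>\<^sub>J b = \<one>\<^sub>J" "(x \<bullet>\<^sub>J x) \<bullet>\<^sub>J b = x" by (auto simp: jb_invertible_def)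
  show "\<exists>\<epsilon>>0. \<epsilon> *\<^sub>R \<one>\<^sub>J \<le>\<^sub>J x \<bullet>\<^sub>J x"
  proof (cases "x = 0")
    case True
    then have "(\<one>\<^sub>J::'a) = 0" using b by (simp add: jprod_simps)
    then have "v = (0::'a)" for v using jprod_unit_left[of v] by (simp add: jprod_simps)
    then show ?thesis by (metis jb_le_refl zero_less_one)
  next
    case False
    \<comment> \<open>\<open>b\<close> undoes the multiplication by \<open>x\<close> on the powers of \<open>x\<close>, hence on \<open>jb_gen x\<close>;
      so \<open>x\<close> is no topological divisor of zero there.\<close>
    have comm: "b \<bullet>\<^sub>J ((x \<bullet>\<^sub>J x) \<bullet>\<^sub>J z) = (x \<bullet>\<^sub>J x) \<bullet>\<^sub>J (b \<bullet>\<^sub>J z)" for z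
    proof -
      \<comment> \<open>Linearising the Jordan identity at \<open>x\<close> in the direction
        \<open>b\<close> yields the term 2xz on both sides, since xb = e.\<close>
      have "b \<bullet>\<^sub>J (z \<bullet>\<^sub>J (x \<bullet>\<^sub>J x)) = (b \<bullet>\<^sub>J z) \<bullet>\<^sub>J (x \<bullet>\<^sub>J x)"
        using jordan_identity_linearized1[of x z b] b(1)
        by (simp add: jprod_simps jprod_commute scaleR_2)
      then show ?thesis by (simp add: jprod_commute)
    qed
    \<comment> \<open>Moving \<open>b\<close> past x^2 shortens a power by two factors, so the
      induction needs the claim for two consecutive powers. The two starting cases are the two
      equations that define \<open>jb_invertible\<close>.\<close>
    have "b \<bullet>\<^sub>J (x \<bullet>\<^sub>J jpoly p x) = jpoly p x \<and> b \<bullet>\<^sub>J (x \<bullet>\<^sub>J (x \<bullet>\<^sub>J jpoly p x)) = x \<bullet>\<^sub>J jpoly p x" for p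
    proof (induction p)
      case 0
      then show ?case by (simp add: jprod_simps)
    next
      case (pCons c p)
      have "x \<bullet>\<^sub>J (x \<bullet>\<^sub>J (x \<bullet>\<^sub>J jpoly p x)) = (x \<bullet>\<^sub>J x) \<bullet>\<^sub>J (x \<bullet>\<^sub>J jpoly p x)"
        by (rule jb_gen_assoc[symmetric, of _ x]) auto
      moreover have "x \<bullet>\<^sub>J (x \<bullet>\<^sub>J jpoly p x) = (x \<bullet>\<^sub>J x) \<bullet>\<^sub>J jpoly p x"
        by (rule jb_gen_assoc[symmetric, of _ x]) auto
      ultimately have "b \<bullet>\<^sub>J (x \<bullet>\<^sub>J (x \<bullet>\<^sub>J (x \<bullet>\<^sub>J jpoly p x))) = x \<bullet>\<^sub>J (x \<bullet>\<^sub>J jpoly p x)"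
        using pCons.IH by (simp add: comm)
      then show ?case
        using pCons.IH b by (simp add: jprod_simps jprod_commute[of b x] jprod_commute[of b "x \<bullet>\<^sub>J x"])
    qed
    then have inv_poly: "b \<bullet>\<^sub>J (x \<bullet>\<^sub>J jpoly p x) = jpoly p x" for p by blast
    have inv: "b \<bullet>\<^sub>J (x \<bullet>\<^sub>J z) = z" if "z \<in> jb_gen x" for z
    proof -
      obtain P where P: "(\<lambda>n. jpoly (P n) x) \<longlonglongrightarrow> z" using \<open>z \<in> jb_gen x\<close> by (rule jb_gen_seqE)
      have "(\<lambda>n. b \<bullet>\<^sub>J (x \<bullet>\<^sub>J jpoly (P n) x)) \<longlonglongrightarrow> b \<bullet>\<^sub>J (x \<bullet>\<^sub>J z)"
        by (intro jprod.tendsto tendsto_const P)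
      with P show ?thesis using LIMSEQ_unique by (simp add: inv_poly) blast
    qed
    define N where "N = norm b"
    have "N \<noteq> 0" using inv[of x] False by (auto simp: N_def jprod_simps)
    then have N: "N > 0" by (simp add: N_def)
    have lower: "norm z \<le> N * norm (x \<bullet>\<^sub>J z)" if "z \<in> jb_gen x" for z
      using norm_jprod_le[of b "x \<bullet>\<^sub>J z"] inv[OF that] by (simp add: N_def)
    \<comment> \<open>With N^2 \<delta> = 1/4 the estimate of \<open>norm z\<close> below absorbs
      its own right-hand side and gives \<open>norm z\<close> at most 2 N^2 = 1/(2 \<delta>). Hence
      y \<ge> 2 \<delta> e, which leaves x^2 \<ge> \<delta> e.\<close>
    define \<delta> where "\<delta> = 1 / (4 * N\<^sup>2)"
    have \<delta>: "\<delta> > 0" using N by (simp add: \<delta>_def)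
    define y where "y = x \<bullet>\<^sub>J x + \<delta> *\<^sub>R \<one>\<^sub>J"
    have y: "\<delta> *\<^sub>R \<one>\<^sub>J \<le>\<^sub>J y" "y \<in> jb_gen x" by (auto simp: y_def jb_le_def)
    obtain z where z: "z \<in> jb_gen x" "y \<bullet>\<^sub>J z = \<one>\<^sub>J" using jb_gen_inverse[OF y(2) \<delta> y(1)] by blast
    have "norm z \<le> N * (N * norm (x \<bullet>\<^sub>J (x \<bullet>\<^sub>J z)))"
      using lower[OF z(1)] lower[of "x \<bullet>\<^sub>J z"] z(1) N
      by (meson jb_gen_prod jb_gen_self mult_left_mono order_less_imp_le order_trans)
    also have "x \<bullet>\<^sub>J (x \<bullet>\<^sub>J z) = \<one>\<^sub>J - \<delta> *\<^sub>R z"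
      using z by (simp add: y_def jprod_simps jb_gen_assoc[of _ x] algebra_simps)
    also have "norm (\<one>\<^sub>J - \<delta> *\<^sub>R z) \<le> 1 + \<delta> * norm z"
      using norm_triangle_ineq4[of "\<one>\<^sub>J" "\<delta> *\<^sub>R z"] norm_jb_unit_le[where 'a='a] \<delta> by simp
    finally have "norm z \<le> N\<^sup>2 * (1 + \<delta> * norm z)" using N by (simp add: power2_eq_square)
    also have "\<dots> = N\<^sup>2 + norm z / 4" using N by (simp add: \<delta>_def field_simps)
    finally have nz: "norm z \<le> 2 * N\<^sup>2" using zero_le_power2[of N] by linarith
    have "((2 * N\<^sup>2) *\<^sub>R \<one>\<^sub>J - z) \<bullet>\<^sub>J y \<in> jb_cone"
    proof (rule jb_cone_prod[of _ _ x])
      show "(2 * N\<^sup>2) *\<^sub>R \<one>\<^sub>J - z \<in> jb_cone"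
        using jb_le_trans[OF jb_le_norm jb_le_unit_mono[OF nz]] by (simp add: jb_le_def)
      show "y \<in> jb_cone" using \<delta> by (simp add: y_def jb_cone_add jb_cone_scaleR)
    qed (use z y in auto)
    then have 1: "(2 * N\<^sup>2) *\<^sub>R y - \<one>\<^sub>J \<in> jb_cone"
      using z(2) by (simp add: jprod_simps jprod_commute)
    have "\<delta> *\<^sub>R \<one>\<^sub>J \<le>\<^sub>J x \<bullet>\<^sub>J x"
    proof -
      have "x \<bullet>\<^sub>J x - \<delta> *\<^sub>R \<one>\<^sub>J = (1 / (2 * N\<^sup>2)) *\<^sub>R ((2 * N\<^sup>2) *\<^sub>R y - \<one>\<^sub>J)"
        using N by (simp add: y_def \<delta>_def scaleR_diff_right scaleR_add_right algebra_simps flip: scaleR_add_left)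
      then show ?thesis using jb_cone_scaleR[OF 1, of "1 / (2 * N\<^sup>2)"] by (simp add: jb_le_def)
    qed
    with \<delta> show ?thesis by blast
  qed
qed

section \<open>Spectrum and functional calculus\<close>

lemma poly_of_real_add:
  "poly (map_poly complex_of_real (p + q)) z =
   poly (map_poly complex_of_real p) z + poly (map_poly complex_of_real q) z"
  by (induction p q rule: poly_induct2) (simp_all add: map_poly_pCons algebra_simps)

lemma poly_of_real_mult:
  "poly (map_poly complex_of_real (p * q)) z =
   poly (map_poly complex_of_real p) z * poly (map_poly complex_of_real q) z"
proof (induction p)
  case (pCons c p)
  have smult: "poly (map_poly complex_of_real (smult r q)) z = of_real r * poly (map_poly complex_of_real q) z" for r q
    by (induction q) (simp_all add: map_poly_pCons algebra_simps)
  show ?case using pCons by (simp add: smult poly_of_real_add map_poly_pCons algebra_simps)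
qed simp

text \<open>Division by the quadratic with a nonreal root z of \<open>Q\<close> leaves a remainder
  of degree at most 1 that vanishes at z, hence is 0. The quadratic is written as a square plus a
  positive constant, because its value at \<open>a\<close> is then visibly bounded below.\<close>

lemma real_poly_factor:
  fixes Q :: "real poly"
  assumes "degree Q > 0"
  shows "(\<exists>t R. Q = [:- t, 1:] * R) \<or>
         (\<exists>u v R. v \<noteq> 0 \<and> Q = ([:- u, 1:] * [:- u, 1:] + [:v\<^sup>2:]) * R)"
proof -
  define ev where "ev p z = poly (map_poly complex_of_real p) z" for p z
  have "degree (map_poly complex_of_real Q) = degree Q" by (rule degree_map_poly) auto
  then have "\<not> constant (poly (map_poly complex_of_real Q))"
    using assms by (simp add: constant_degree)
  then obtain z where z: "ev Q z = 0"
    unfolding ev_def using fundamental_theorem_of_algebra by blast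
  show ?thesis
  proof (cases "Im z = 0")
    case True
    then have zr: "z = of_real (Re z)" by (simp add: complex_eq_iff)
    have "ev p (of_real x) = of_real (poly p x)" for p x
      unfolding ev_def by (induction p) (simp_all add: map_poly_pCons)
    then have "poly Q (Re z) = 0" using z zr by (metis of_real_eq_0_iff)
    then have "[:- Re z, 1:] dvd Q" by (simp add: poly_eq_0_iff_dvd)
    then show ?thesis unfolding dvd_def by blast
  next
    case False
    define u v where "u = Re z" and "v = Im z"
    define D where "D = [:- u, 1:] * [:- u, 1:] + [:v\<^sup>2:]"
    have D: "D = [:u\<^sup>2 + v\<^sup>2, - 2 * u, 1:]" by (simp add: D_def power2_eq_square)
    have "ev D z = 0"
      by (simp add: D ev_def map_poly_pCons complex_eq_iff u_def v_def power2_eq_square algebra_simps)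
    moreover have "ev Q z = ev D z * ev (Q div D) z + ev (Q mod D) z"
      unfolding ev_def by (simp flip: poly_of_real_mult poly_of_real_add)
    ultimately have R: "ev (Q mod D) z = 0" using z by simp
    have "degree (Q mod D) < 2" using degree_mod_less'[of D Q] by (cases "Q mod D = 0") (auto simp: D)
    then obtain c0 c1 where c: "Q mod D = [:c0, c1:]"
      by (metis (no_types, opaque_lifting) One_nat_def degree_eq_zeroE degree_pCons_eq_if less_2_cases
          nat.inject pCons_cases pCons_0_0)
    from R have "c1 * v = 0" "c0 + c1 * u = 0"
      by (auto simp: c ev_def map_poly_pCons complex_eq_iff u_def v_def algebra_simps)
    then have "Q mod D = 0" using False by (simp add: c v_def)
    then have "Q = D * (Q div D)" by (metis add.right_neutral mult_div_mod_eq)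
    then show ?thesis using False unfolding D_def v_def by blast
  qed
qed

section \<open>Polynomials on the spectrum\<close>

lemma in_jb_spectrum_iff:
  "t \<in> jb_spectrum a \<longleftrightarrow> \<not> (\<exists>\<epsilon>>0. \<epsilon> *\<^sub>R \<one>\<^sub>J \<le>\<^sub>J (a - t *\<^sub>R \<one>\<^sub>J) \<bullet>\<^sub>J (a - t *\<^sub>R \<one>\<^sub>J))"
  by (simp add: jb_spectrum_def jb_invertible_iff)

lemma jb_le_prod_lower_bound:
  assumes "r *\<^sub>R \<one>\<^sub>J \<le>\<^sub>J x" "s *\<^sub>R \<one>\<^sub>J \<le>\<^sub>J y" "r \<ge> 0" "s \<ge> 0" "x \<in> jb_gen a" "y \<in> jb_gen a"
  shows "(r * s) *\<^sub>R \<one>\<^sub>J \<le>\<^sub>J x \<bullet>\<^sub>J y"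
proof -
  have y: "y \<in> jb_cone"
    using jb_le_trans[OF jb_le_unit_mono[OF assms(4)] assms(2)] by (simp add: jb_nonneg_iff)
  have "(x - r *\<^sub>R \<one>\<^sub>J) \<bullet>\<^sub>J y + r *\<^sub>R (y - s *\<^sub>R \<one>\<^sub>J) \<in> jb_cone"
    using assms y by (intro jb_cone_add jb_cone_scaleR jb_cone_prod[of _ _ a]) (auto simp: jb_le_def)
  then show ?thesis by (simp add: jb_le_def jprod_simps algebra_simps)
qed

text \<open>One half of spectral mapping: the hypothesis says that \<open>jpoly Q a\<close> is not
  invertible. A quadratic factor without real roots, or a linear factor whose root is outside the
  spectrum, is invertible at \<open>a\<close> and can be split off, which lowers the degree.\<close>

lemma poly_root_in_jb_spectrum:
  assumes "Q \<noteq> 0" "\<not> (\<exists>\<epsilon>>0. \<epsilon> *\<^sub>R \<one>\<^sub>J \<le>\<^sub>J jpoly (Q * Q) a)"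
  shows "\<exists>t\<in>jb_spectrum a. poly Q t = 0"
  using assms
proof (induction "degree Q" arbitrary: Q rule: less_induct)
  case (less Q)
  show ?case
  proof (cases "degree Q = 0")
    case True
    then obtain c where c: "Q = [:c:]" using degree_eq_zeroE by blast
    with less.prems(1) have "c\<^sup>2 > 0" by simp
    moreover have "jpoly (Q * Q) a = c\<^sup>2 *\<^sub>R \<one>\<^sub>J" by (simp add: c jprod_simps power2_eq_square)
    ultimately show ?thesis using less.prems(2) by (metis jb_le_refl)
  next
    case False
    have step: "\<exists>t\<in>jb_spectrum a. poly Q t = 0"
      if Q: "Q = D * R" and D: "degree D > 0" and \<epsilon>: "\<epsilon> > 0" "\<epsilon> *\<^sub>R \<one>\<^sub>J \<le>\<^sub>J jpoly (D * D) a" for D R \<epsilon>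
    proof -
      have nz: "R \<noteq> 0" "D \<noteq> 0" using Q less.prems(1) by auto
      have "degree R < degree Q" using Q D nz by (simp add: degree_mult_eq)
      moreover have "\<not> (\<exists>\<delta>>0. \<delta> *\<^sub>R \<one>\<^sub>J \<le>\<^sub>J jpoly (R * R) a)"
      proof
        assume "\<exists>\<delta>>0. \<delta> *\<^sub>R \<one>\<^sub>J \<le>\<^sub>J jpoly (R * R) a"
        then obtain \<delta> where \<delta>: "\<delta> > 0" "\<delta> *\<^sub>R \<one>\<^sub>J \<le>\<^sub>J jpoly (R * R) a" by blast
        have "(\<epsilon> * \<delta>) *\<^sub>R \<one>\<^sub>J \<le>\<^sub>J jpoly (D * D) a \<bullet>\<^sub>J jpoly (R * R) a"
          using \<delta> \<epsilon> by (intro jb_le_prod_lower_bound[of _ _ _ _ a]) (auto simp del: jpoly_mult)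
        moreover have "jpoly (D * D) a \<bullet>\<^sub>J jpoly (R * R) a = jpoly (Q * Q) a"
          unfolding jpoly_mult[symmetric] by (simp add: Q mult_ac)
        ultimately show False using less.prems(2) \<epsilon>(1) \<delta>(1) by (metis mult_pos_pos)
      qed
      ultimately obtain t where "t \<in> jb_spectrum a" "poly R t = 0" using less.hyps nz by blast
      then show ?thesis using Q by auto
    qed
    from real_poly_factor[of Q] False consider
        t R where "Q = [:- t, 1:] * R"
      | u v R where "v \<noteq> 0" "Q = ([:- u, 1:] * [:- u, 1:] + [:v\<^sup>2:]) * R" by auto
    then show ?thesis
    proof cases
      case 1
      show ?thesis
      proof (cases "t \<in> jb_spectrum a")
        case True
        then show ?thesis using 1 by (intro bexI[of _ t]) auto
      next
        case False
        then obtain \<epsilon> where "\<epsilon> > 0" "\<epsilon> *\<^sub>R \<one>\<^sub>J \<le>\<^sub>J (a - t *\<^sub>R \<one>\<^sub>J) \<bullet>\<^sub>J (a - t *\<^sub>R \<one>\<^sub>J)"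
          by (auto simp: in_jb_spectrum_iff)
        moreover have "jpoly [:- t, 1:] a = a - t *\<^sub>R \<one>\<^sub>J" by (simp add: jprod_simps)
        ultimately have "\<epsilon> > 0" "\<epsilon> *\<^sub>R \<one>\<^sub>J \<le>\<^sub>J jpoly ([:- t, 1:] * [:- t, 1:]) a"
          by (simp_all only: jpoly_mult)
        then show ?thesis by (rule step[OF 1, rotated]) simp
      qed
    next
      case 2
      let ?L = "[:- u, 1:] :: real poly"
      have "jpoly (?L * ?L + [:v\<^sup>2:]) a = jpoly ?L a \<bullet>\<^sub>J jpoly ?L a + v\<^sup>2 *\<^sub>R \<one>\<^sub>J"
        by (simp only: jpoly_add jpoly_mult) (simp add: jprod_simps)
      then have "v\<^sup>2 *\<^sub>R \<one>\<^sub>J \<le>\<^sub>J jpoly (?L * ?L + [:v\<^sup>2:]) a"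
        by (simp add: jb_le_def del: jpoly_pCons)
      then have "(v\<^sup>2 * v\<^sup>2) *\<^sub>R \<one>\<^sub>J \<le>\<^sub>J jpoly ((?L * ?L + [:v\<^sup>2:]) * (?L * ?L + [:v\<^sup>2:])) a"
        unfolding jpoly_mult[of "?L * ?L + [:v\<^sup>2:]"]
        by (intro jb_le_prod_lower_bound[of _ _ _ _ a]) auto
      then show ?thesis using 2(1) by (intro step[OF 2(2), of "v\<^sup>2 * v\<^sup>2"]) auto
    qed
  qed
qed

text \<open>Otherwise some polynomial \<open>Y\<close> vanishes at \<open>t\<close> although -Y(a)
  has a positive lower bound. Since \<open>Y\<close> is divisible by X - t, Y(a)^2 is at most a
  multiple of (a - t e)^2, which would make a - t e invertible.\<close>

lemma poly_spectrum_le_norm: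
  assumes t: "t \<in> jb_spectrum a"
  shows "\<bar>poly p t\<bar> \<le> norm (jpoly p a)"
proof (rule ccontr)
  assume "\<not> \<bar>poly p t\<bar> \<le> norm (jpoly p a)"
  \<comment> \<open>The sign makes the value at \<open>t\<close> equal to
    \<open>\<bar>poly p t\<bar>\<close>, so that one one-sided estimate covers both signs.\<close>
  define \<sigma> where "\<sigma> = sgn (poly p t)"
  define d where "d = \<bar>poly p t\<bar> - norm (jpoly p a)"
  have d: "d > 0" using \<open>\<not> _\<close> by (simp add: d_def)
  define Y where "Y = smult \<sigma> p - [:\<bar>poly p t\<bar>:]"
  have "poly Y t = 0" by (simp add: Y_def \<sigma>_def sgn_mult_self_eq abs_sgn mult.commute)
  then obtain R where R: "Y = [:- t, 1:] * R" by (auto simp: poly_eq_0_iff_dvd elim: dvdE)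
  have "norm (jpoly (smult \<sigma> p) a) \<le> norm (jpoly p a)"
    by (auto simp: \<sigma>_def sgn_if)
  then have "jpoly (smult \<sigma> p) a \<le>\<^sub>J norm (jpoly p a) *\<^sub>R \<one>\<^sub>J"
    using jb_le_trans[OF jb_le_norm jb_le_unit_mono] by blast
  then have "d *\<^sub>R \<one>\<^sub>J \<le>\<^sub>J jpoly (- Y) a"
    by (simp add: Y_def jb_le_def d_def jprod_simps algebra_simps)
  then have "(d * d) *\<^sub>R \<one>\<^sub>J \<le>\<^sub>J jpoly (- Y) a \<bullet>\<^sub>J jpoly (- Y) a"
    using d by (intro jb_le_prod_lower_bound[of _ _ _ _ a]) (auto simp del: jpoly_minus)
  also have "jpoly (- Y) a \<bullet>\<^sub>J jpoly (- Y) a = jpoly (Y * Y) a"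
    by (simp add: jprod_simps)
  finally have 1: "(d * d) *\<^sub>R \<one>\<^sub>J \<le>\<^sub>J jpoly (Y * Y) a" .
  define x where "x = a - t *\<^sub>R \<one>\<^sub>J"
  have x: "jpoly [:- t, 1:] a = x" by (simp add: jprod_simps x_def)
  have "jpoly (Y * Y) a = jpoly (([:- t, 1:] * [:- t, 1:]) * (R * R)) a"
    by (simp only: R mult_ac)
  also have "\<dots> = (x \<bullet>\<^sub>J x) \<bullet>\<^sub>J jpoly (R * R) a" by (simp only: jpoly_mult x)
  finally have Y: "jpoly (Y * Y) a = (x \<bullet>\<^sub>J x) \<bullet>\<^sub>J jpoly (R * R) a" .
  define N where "N = norm (jpoly (R * R) a) + 1"
  have N: "N > 0" by (simp add: N_def add_nonneg_pos)
  have "(x \<bullet>\<^sub>J x) \<bullet>\<^sub>J (N *\<^sub>R \<one>\<^sub>J - jpoly (R * R) a) \<in> jb_cone"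
  proof (rule jb_cone_prod[of _ _ a])
    show "N *\<^sub>R \<one>\<^sub>J - jpoly (R * R) a \<in> jb_cone"
      using jb_le_trans[OF jb_le_norm jb_le_unit_mono[of "norm (jpoly (R * R) a)" N]]
      by (simp add: jb_le_def N_def del: jpoly_mult)
  qed (auto simp: x_def)
  then have "jpoly (Y * Y) a \<le>\<^sub>J N *\<^sub>R (x \<bullet>\<^sub>J x)"
    by (simp add: Y jb_le_def jprod_simps del: jpoly_mult)
  with 1 have "(d * d) *\<^sub>R \<one>\<^sub>J \<le>\<^sub>J N *\<^sub>R (x \<bullet>\<^sub>J x)" by (rule jb_le_trans)
  from jb_le_scaleR_mono[OF this, of "1/N"] N
  have "(d * d / N) *\<^sub>R \<one>\<^sub>J \<le>\<^sub>J x \<bullet>\<^sub>J x" by simp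
  moreover have "d * d / N > 0" using d N by simp
  ultimately show False using t unfolding in_jb_spectrum_iff x_def by blast
qed

section \<open>The continuous functional calculus\<close>

text \<open>The graph of the functional calculus, as a relation: the same polynomial must be close
  to \<open>f\<close> on the spectrum and to \<open>y\<close> in norm. In this form the algebraic
  laws precede existence and uniqueness, and no approximating sequence has to be chosen.\<close>

definition jb_approx :: "'a::jb_algebra \<Rightarrow> (real \<Rightarrow> real) \<Rightarrow> 'a \<Rightarrow> bool" where
  "jb_approx a f y \<longleftrightarrow>
     (\<forall>e>0. \<exists>p. (\<forall>t\<in>jb_spectrum a. \<bar>f t - poly p t\<bar> \<le> e) \<and> norm (y - jpoly p a) \<le> e)"

lemma jb_approxE:
  assumes "jb_approx a f y" "e > 0"
  obtains p where "\<And>t. t \<in> jb_spectrum a \<Longrightarrow> \<bar>f t - poly p t\<bar> \<le> e" "norm (y - jpoly p a) \<le> e"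
  using assms unfolding jb_approx_def by blast

lemma jb_approx_in_jb_gen:
  assumes "jb_approx a f y"
  shows "y \<in> jb_gen a"
  unfolding jb_gen_def closure_approachable
proof (intro allI impI)
  fix e :: real assume "e > 0"
  with assms obtain p where "norm (y - jpoly p a) \<le> e / 2"
    by (meson jb_approxE half_gt_zero)
  with \<open>e > 0\<close> show "\<exists>z\<in>range (\<lambda>p. jpoly p a). dist z y < e"
    by (intro bexI[of _ "jpoly p a"]) (auto simp: dist_norm norm_minus_commute)
qed

lemma jb_approx_abs_le_norm:
  assumes "jb_approx a f y" "t \<in> jb_spectrum a"
  shows "\<bar>f t\<bar> \<le> norm y"
proof (rule field_le_epsilon)
  fix e :: real assume "e > 0"
  with assms(1) obtain p where p: "\<And>t. t \<in> jb_spectrum a \<Longrightarrow> \<bar>f t - poly p t\<bar> \<le> e / 2"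
      "norm (y - jpoly p a) \<le> e / 2" by (meson jb_approxE half_gt_zero)
  have "norm (jpoly p a) \<le> norm y + e / 2"
    using p(2) norm_triangle_ineq2[of "jpoly p a" y] by (simp add: norm_minus_commute)
  then show "\<bar>f t\<bar> \<le> norm y + e"
    using p(1)[OF assms(2)] poly_spectrum_le_norm[OF assms(2), of p] by linarith
qed

lemma jb_approx_poly: "jb_approx a (poly p) (jpoly p a)"
  unfolding jb_approx_def by (intro allI impI exI[of _ p]) auto

lemma jb_approx_const: "jb_approx a (\<lambda>t. r) (r *\<^sub>R \<one>\<^sub>J)"
proof -
  have "poly [:r:] = (\<lambda>t. r)" by auto
  with jb_approx_poly[of a "[:r:]"] show ?thesis by (simp add: jprod_simps)
qed

lemma jb_approx_id: "jb_approx a (\<lambda>t. t) a"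
proof -
  have "poly [:0, 1:] = (\<lambda>t::real. t)" by auto
  with jb_approx_poly[of a "[:0, 1:]"] show ?thesis by (simp add: jprod_simps)
qed

lemma jb_approx_add:
  assumes "jb_approx a f x" "jb_approx a g y"
  shows "jb_approx a (\<lambda>t. f t + g t) (x + y)"
  unfolding jb_approx_def
proof (intro allI impI)
  fix e :: real assume "e > 0"
  then have e: "e / 2 > 0" by simp
  obtain p where p: "\<And>t. t \<in> jb_spectrum a \<Longrightarrow> \<bar>f t - poly p t\<bar> \<le> e / 2"
      "norm (x - jpoly p a) \<le> e / 2" using jb_approxE[OF assms(1) e] by blast
  obtain q where q: "\<And>t. t \<in> jb_spectrum a \<Longrightarrow> \<bar>g t - poly q t\<bar> \<le> e / 2"
      "norm (y - jpoly q a) \<le> e / 2" using jb_approxE[OF assms(2) e] by blast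
  show "\<exists>p. (\<forall>t\<in>jb_spectrum a. \<bar>f t + g t - poly p t\<bar> \<le> e) \<and> norm (x + y - jpoly p a) \<le> e"
  proof (intro exI[of _ "p + q"] conjI ballI)
    fix t assume "t \<in> jb_spectrum a"
    from p(1)[OF this] q(1)[OF this] show "\<bar>f t + g t - poly (p + q) t\<bar> \<le> e"
      unfolding poly_add by linarith
  next
    show "norm (x + y - jpoly (p + q) a) \<le> e"
      using norm_triangle_mono[OF p(2) q(2)] by (simp add: algebra_simps)
  qed
qed

lemma jb_approx_mult:
  assumes "jb_approx a f x" "jb_approx a g y"
  shows "jb_approx a (\<lambda>t. f t * g t) (x \<bullet>\<^sub>J y)"
  unfolding jb_approx_def
proof (intro allI impI)
  fix e :: real assume "e > 0"
  \<comment> \<open>Approximating both factors up to \<open>d\<close> costs at most d (F + G + d),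
    where \<open>F\<close> and \<open>G\<close> bound the factors. As d \<le> 1, the chosen quotient
    suffices; the same bound serves the functions and the elements, because a function is bounded by
    the norm of its element.\<close>
  define d where "d = min 1 (e / (norm x + norm y + 1))"
  have N: "norm x + norm y + 1 > 0" by (simp add: add_nonneg_pos)
  have d: "d > 0" "d \<le> 1" using \<open>e > 0\<close> N by (auto simp: d_def)
  have "d \<le> e / (norm x + norm y + 1)" by (simp add: d_def)
  then have de: "d * (norm x + norm y + 1) \<le> e" using N by (simp add: pos_le_divide_eq)
  obtain p where p: "\<And>t. t \<in> jb_spectrum a \<Longrightarrow> \<bar>f t - poly p t\<bar> \<le> d"
      "norm (x - jpoly p a) \<le> d" using jb_approxE[OF assms(1) d(1)] by blast
  obtain q where q: "\<And>t. t \<in> jb_spectrum a \<Longrightarrow> \<bar>g t - poly q t\<bar> \<le> d"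
      "norm (y - jpoly q a) \<le> d" using jb_approxE[OF assms(2) d(1)] by blast
  have bound: "F * d + d * (G + d) \<le> e" if "F \<le> norm x" "G \<le> norm y" for F G
  proof -
    have "F * d + d * (G + d) = d * (F + G + d)" by (simp add: algebra_simps)
    also have "\<dots> \<le> d * (norm x + norm y + 1)" using that d by (intro mult_left_mono) auto
    finally show ?thesis using de by simp
  qed
  show "\<exists>p. (\<forall>t\<in>jb_spectrum a. \<bar>f t * g t - poly p t\<bar> \<le> e) \<and> norm (x \<bullet>\<^sub>J y - jpoly p a) \<le> e"
  proof (intro exI[of _ "p * q"] conjI ballI)
    fix t assume t: "t \<in> jb_spectrum a"
    have "f t * g t - poly (p * q) t = f t * (g t - poly q t) + (f t - poly p t) * poly q t"
      by (simp add: algebra_simps)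
    also have "\<bar>\<dots>\<bar> \<le> \<bar>f t\<bar> * \<bar>g t - poly q t\<bar> + \<bar>f t - poly p t\<bar> * \<bar>poly q t\<bar>"
      by (metis abs_mult abs_triangle_ineq)
    also have "\<dots> \<le> \<bar>f t\<bar> * d + d * (\<bar>g t\<bar> + d)"
      using p(1)[OF t] q(1)[OF t] d by (intro add_mono mult_mono) auto
    also have "\<dots> \<le> e"
      using assms t by (intro bound jb_approx_abs_le_norm)
    finally show "\<bar>f t * g t - poly (p * q) t\<bar> \<le> e" .
  next
    have nq: "norm (jpoly q a) \<le> norm y + d"
      using q(2) norm_triangle_ineq2[of "jpoly q a" y] by (simp add: norm_minus_commute)
    have "x \<bullet>\<^sub>J y - jpoly (p * q) a = x \<bullet>\<^sub>J (y - jpoly q a) + (x - jpoly p a) \<bullet>\<^sub>J jpoly q a"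
      by (simp add: jprod_simps)
    also have "norm \<dots> \<le> norm x * norm (y - jpoly q a) + norm (x - jpoly p a) * norm (jpoly q a)"
      by (intro norm_triangle_mono norm_jprod_le)
    also have "\<dots> \<le> norm x * d + d * (norm y + d)"
      using p(2) q(2) nq d by (intro add_mono mult_mono) auto
    also have "\<dots> \<le> e" by (rule bound) auto
    finally show "norm (x \<bullet>\<^sub>J y - jpoly (p * q) a) \<le> e" .
  qed
qed

lemma jb_approx_scaleR:
  assumes "jb_approx a f x"
  shows "jb_approx a (\<lambda>t. r * f t) (r *\<^sub>R x)"
  using jb_approx_mult[OF jb_approx_poly[of a "[:r:]"] assms] by (simp add: jprod_simps)

lemma jb_approx_cong:
  assumes "jb_approx a f x" "\<And>t. t \<in> jb_spectrum a \<Longrightarrow> f t = g t"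
  shows "jb_approx a g x"
  using assms unfolding jb_approx_def by simp

context
  fixes a :: "'a::jb_algebra"
  assumes nontriv: "(\<one>\<^sub>J :: 'a) \<noteq> 0"
begin

lemma norm_unit: "norm (\<one>\<^sub>J :: 'a) = 1"
  using norm_jb_unit[OF nontriv] .

text \<open>If Q(a) = r^2 e - p(a)^2 were invertible, then, being positive, it would have a lower
  bound and p(a)^2 would have norm below r^2. So \<open>Q\<close> has a root in the spectrum. The
  condition that \<open>Q\<close> is not the zero polynomial fails only for constant
  \<open>p\<close>, where a nonempty spectrum suffices; nonemptiness comes from this lemma with p =
  X.\<close>

lemma poly_spectrum_attains_norm_aux:
  assumes "[:(norm (jpoly p a))\<^sup>2:] - p * p \<noteq> 0"
  shows "\<exists>t\<in>jb_spectrum a. \<bar>poly p t\<bar> = norm (jpoly p a)"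
proof -
  define r where "r = norm (jpoly p a)"
  define Q where "Q = [:r\<^sup>2:] - p * p"
  have Q: "jpoly Q a = r\<^sup>2 *\<^sub>R \<one>\<^sub>J - jpoly p a \<bullet>\<^sub>J jpoly p a" by (simp add: Q_def jprod_simps)
  have Qpos: "jpoly Q a \<in> jb_cone"
    using jb_le_norm[of "jpoly p a \<bullet>\<^sub>J jpoly p a"] by (simp add: Q jb_le_def norm_jsquare r_def)
  have "\<not> (\<exists>\<epsilon>>0. \<epsilon> *\<^sub>R \<one>\<^sub>J \<le>\<^sub>J jpoly (Q * Q) a)"
  proof
    assume "\<exists>\<epsilon>>0. \<epsilon> *\<^sub>R \<one>\<^sub>J \<le>\<^sub>J jpoly (Q * Q) a"
    then obtain \<epsilon> where \<epsilon>: "\<epsilon> > 0" "\<epsilon> *\<^sub>R \<one>\<^sub>J \<le>\<^sub>J jpoly Q a \<bullet>\<^sub>J jpoly Q a" by auto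
    define N where "N = norm (jpoly Q a) + 1"
    have N: "N > 0" by (simp add: N_def add_nonneg_pos)
    from \<epsilon>(2) have "\<epsilon> *\<^sub>R \<one>\<^sub>J \<le>\<^sub>J N *\<^sub>R jpoly Q a"
      by (rule jb_le_trans) (rule square_jb_le, use Qpos in \<open>auto simp: N_def\<close>)
    from jb_le_scaleR_mono[OF this, of "1/N"] N
    have *: "(\<epsilon>/N) *\<^sub>R \<one>\<^sub>J \<le>\<^sub>J jpoly Q a" by simp
    have le: "jpoly p a \<bullet>\<^sub>J jpoly p a \<le>\<^sub>J (r\<^sup>2 - \<epsilon>/N) *\<^sub>R \<one>\<^sub>J"
      using * by (simp add: Q jb_le_def algebra_simps)
    have "0 *\<^sub>R \<one>\<^sub>J \<le>\<^sub>J (r\<^sup>2 - \<epsilon>/N) *\<^sub>R (\<one>\<^sub>J::'a)"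
      using jb_le_trans[OF _ le, of 0] by (simp add: jb_nonneg_iff)
    then have "0 \<le> r\<^sup>2 - \<epsilon>/N" by (rule unit_scaleR_jb_le_imp_le) (rule nontriv)
    from norm_le_of_nonneg_jb_le[OF jb_cone_square le this]
    have "r\<^sup>2 \<le> r\<^sup>2 - \<epsilon>/N" by (simp add: norm_jsquare r_def)
    moreover have "\<epsilon> / N > 0" using N \<epsilon> by simp
    ultimately show False by linarith
  qed
  with assms obtain t where t: "t \<in> jb_spectrum a" "poly Q t = 0"
    using poly_root_in_jb_spectrum[of Q a] by (auto simp: Q_def r_def)
  then have "(poly p t)\<^sup>2 = r\<^sup>2" by (simp add: Q_def power2_eq_square)
  then have "\<bar>poly p t\<bar> = r" by (metis norm_ge_zero power2_abs power2_eq_iff_nonneg abs_ge_zero r_def)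
  with t(1) show ?thesis by (auto simp: r_def)
qed

lemma jb_spectrum_nonempty: "jb_spectrum a \<noteq> {}"
proof -
  have "[:(norm (jpoly [:0,1:] a))\<^sup>2:] - [:0,1:] * [:0,1:] \<noteq> (0 :: real poly)" by simp
  from poly_spectrum_attains_norm_aux[OF this] show ?thesis by blast
qed

lemma poly_spectrum_attains_norm:
  "\<exists>t\<in>jb_spectrum a. \<bar>poly p t\<bar> = norm (jpoly p a)"
proof (cases "[:(norm (jpoly p a))\<^sup>2:] - p * p = 0")
  case True
  then have "degree (p * p) = 0" by (metis degree_pCons_0 right_minus_eq)
  then have "degree p = 0" by (cases "p = 0") (auto simp: degree_mult_eq)
  then obtain c where "p = [:c:]" using degree_eq_zeroE by blast
  then show ?thesis using jb_spectrum_nonempty by (auto simp: jprod_simps norm_unit)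
next
  case False
  then show ?thesis by (rule poly_spectrum_attains_norm_aux)
qed

lemma compact_jb_spectrum: "compact (jb_spectrum a)"
proof -
  have "\<bar>t\<bar> \<le> norm a" if "t \<in> jb_spectrum a" for t
    using poly_spectrum_le_norm[OF that, of "[:0,1:]"] by (simp add: jprod_simps)
  then have "bounded (jb_spectrum a)" by (auto simp: bounded_iff)
  moreover have "open (- jb_spectrum a)"
    unfolding open_dist
  proof
    fix t assume "t \<in> - jb_spectrum a"
    then obtain \<epsilon> where \<epsilon>: "\<epsilon> > 0" "\<epsilon> *\<^sub>R \<one>\<^sub>J \<le>\<^sub>J (a - t *\<^sub>R \<one>\<^sub>J) \<bullet>\<^sub>J (a - t *\<^sub>R \<one>\<^sub>J)"
      by (auto simp: in_jb_spectrum_iff)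
    define x where "x = a - t *\<^sub>R \<one>\<^sub>J"
    \<comment> \<open>Shifting by h changes (a - t e)^2 by 2h x + h^2 e, and this choice of
      \<open>d\<close> lets the linear term cost at most \<epsilon>/2.\<close>
    define d where "d = \<epsilon> / (4 * (norm x + 1))"
    have N: "norm x + 1 > 0" by (simp add: add_nonneg_pos)
    have d: "d > 0" using N \<epsilon> by (simp add: d_def)
    have "s \<in> - jb_spectrum a" if "dist s t < d" for s
    proof -
      define h where "h = t - s"
      have h: "\<bar>h\<bar> < d" using that by (simp add: h_def dist_real_def abs_minus_commute)
      have "a - s *\<^sub>R \<one>\<^sub>J = x + h *\<^sub>R \<one>\<^sub>J" by (simp add: x_def h_def algebra_simps)
      then have eq: "(a - s *\<^sub>R \<one>\<^sub>J) \<bullet>\<^sub>J (a - s *\<^sub>R \<one>\<^sub>J) = x \<bullet>\<^sub>J x + (2 * h) *\<^sub>R x + h\<^sup>2 *\<^sub>R \<one>\<^sub>J"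
        by (simp add: jprod_simps power2_eq_square algebra_simps flip: scaleR_2)
      have "\<bar>2 * h\<bar> * norm x \<le> 2 * d * (norm x + 1)" using h by (intro mult_mono) auto
      also have "\<dots> = \<epsilon> / 2" using N by (simp add: d_def field_simps)
      finally have "norm ((2 * h) *\<^sub>R x) \<le> \<epsilon> / 2" by simp
      then have "- ((\<epsilon>/2) *\<^sub>R \<one>\<^sub>J) \<le>\<^sub>J (2 * h) *\<^sub>R x"
        using jb_le_trans[OF jb_le_unit_mono[of "- (\<epsilon>/2)" "- norm ((2 * h) *\<^sub>R x)"],
            of "(2 * h) *\<^sub>R x"] neg_norm_jb_le[of "(2 * h) *\<^sub>R x"]
        by simp
      from jb_le_add_mono[OF jb_le_add_mono[OF \<epsilon>(2) this] jb_le_unit_mono[of 0 "h\<^sup>2"]]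
      have "(\<epsilon>/2) *\<^sub>R \<one>\<^sub>J \<le>\<^sub>J (a - s *\<^sub>R \<one>\<^sub>J) \<bullet>\<^sub>J (a - s *\<^sub>R \<one>\<^sub>J)"
        by (simp add: eq x_def[symmetric] flip: scaleR_diff_left)
      then show ?thesis using \<epsilon>(1) by (auto simp: in_jb_spectrum_iff intro!: exI[of _ "\<epsilon>/2"])
    qed
    with d show "\<exists>e>0. \<forall>y. dist y t < e \<longrightarrow> y \<in> - jb_spectrum a" by blast
  qed
  ultimately show ?thesis by (simp add: compact_eq_bounded_closed closed_def)
qed

lemma jb_approx_norm_le:
  assumes "jb_approx a f y" "\<And>t. t \<in> jb_spectrum a \<Longrightarrow> \<bar>f t\<bar> \<le> B"
  shows "norm y \<le> B"
proof (rule field_le_epsilon)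
  fix e :: real assume "e > 0"
  then have e: "e / 2 > 0" by simp
  obtain p where p: "\<And>t. t \<in> jb_spectrum a \<Longrightarrow> \<bar>f t - poly p t\<bar> \<le> e / 2"
      "norm (y - jpoly p a) \<le> e / 2" using jb_approxE[OF assms(1) e] by blast
  obtain t where t: "t \<in> jb_spectrum a" "\<bar>poly p t\<bar> = norm (jpoly p a)"
    using poly_spectrum_attains_norm by blast
  have "norm y \<le> norm (jpoly p a) + e / 2"
    using p(2) norm_triangle_ineq2[of y "jpoly p a"] by simp
  then show "norm y \<le> B + e" using t p(1)[OF t(1)] assms(2)[OF t(1)] by linarith
qed

lemma jb_approx_unique:
  assumes "jb_approx a f x" "jb_approx a f y"
  shows "x = y"
proof -
  have "jb_approx a (\<lambda>t. f t + (- 1) * f t) (x + (- 1) *\<^sub>R y)"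
    by (intro jb_approx_add jb_approx_scaleR assms)
  then have "norm (x + (- 1) *\<^sub>R y) \<le> 0" by (rule jb_approx_norm_le) simp
  then show ?thesis by simp
qed

lemma poly_dense_on_jb_spectrum:
  assumes "continuous_on (jb_spectrum a) f" "e > 0"
  obtains p where "\<And>t. t \<in> jb_spectrum a \<Longrightarrow> \<bar>f t - poly p t\<bar> < e"
proof -
  obtain g where g: "real_polynomial_function g" "\<And>t. t \<in> jb_spectrum a \<Longrightarrow> \<bar>f t - g t\<bar> < e"
    using Stone_Weierstrass_real_polynomial_function[OF compact_jb_spectrum assms] by blast
  from g(1) obtain c n where "g = (\<lambda>x. \<Sum>i\<le>n. c i * x ^ i)"
    using real_polynomial_function_iff_sum by blast
  then have "g = poly (\<Sum>i\<le>n. monom (c i) i)" by (auto simp: poly_sum poly_monom)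
  with g(2) that show ?thesis by blast
qed

lemma jb_approx_exists:
  assumes f: "continuous_on (jb_spectrum a) f"
  shows "\<exists>y. jb_approx a f y"
proof -
  have "\<exists>p. \<forall>t\<in>jb_spectrum a. \<bar>f t - poly p t\<bar> < inverse (real (Suc n))" for n
    by (rule poly_dense_on_jb_spectrum[OF f, of "inverse (real (Suc n))"]) auto
  then obtain P where P: "\<And>n t. t \<in> jb_spectrum a \<Longrightarrow> \<bar>f t - poly (P n) t\<bar> < inverse (real (Suc n))"
    by metis
  have bound: "norm (jpoly (P m) a - jpoly (P n) a) \<le> inverse (real (Suc m)) + inverse (real (Suc n))" for m n
  proof -
    obtain t where "t \<in> jb_spectrum a" "\<bar>poly (P m - P n) t\<bar> = norm (jpoly (P m - P n) a)"
      using poly_spectrum_attains_norm by blast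
    then show ?thesis using P[of t m] P[of t n] by simp
  qed
  have "Cauchy (\<lambda>n. jpoly (P n) a)"
    unfolding Cauchy_altdef2
  proof (intro allI impI)
    fix e :: real assume "e > 0"
    then obtain N where N: "inverse (real (Suc N)) < e / 2" using reals_Archimedean[of "e / 2"] by auto
    have "dist (jpoly (P n) a) (jpoly (P N) a) < e" if "n \<ge> N" for n
    proof -
      have "inverse (real (Suc n)) \<le> inverse (real (Suc N))" using that by (intro le_imp_inverse_le) auto
      then show ?thesis using bound[of n N] N unfolding dist_norm by linarith
    qed
    then show "\<exists>N. \<forall>n\<ge>N. dist (jpoly (P n) a) (jpoly (P N) a) < e" by blast
  qed
  then obtain y where y: "(\<lambda>n. jpoly (P n) a) \<longlonglongrightarrow> y"
    by (auto simp: Cauchy_convergent_iff convergent_def)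
  have "jb_approx a f y"
    unfolding jb_approx_def
  proof (intro allI impI)
    fix e :: real assume e: "e > 0"
    from LIMSEQ_D[OF y e] obtain N1 where N1: "\<And>n. n \<ge> N1 \<Longrightarrow> norm (jpoly (P n) a - y) < e" by blast
    from e obtain N2 where N2: "inverse (real (Suc N2)) < e" using reals_Archimedean by blast
    define n where "n = max N1 N2"
    have "inverse (real (Suc n)) \<le> inverse (real (Suc N2))"
      by (intro le_imp_inverse_le) (auto simp: n_def)
    then have "\<bar>f t - poly (P n) t\<bar> \<le> e" if "t \<in> jb_spectrum a" for t
      using P[OF that, of n] N2 by linarith
    moreover have "norm (y - jpoly (P n) a) \<le> e"
      using N1[of n] by (simp add: n_def norm_minus_commute)
    ultimately show "\<exists>p. (\<forall>t\<in>jb_spectrum a. \<bar>f t - poly p t\<bar> \<le> e) \<and> norm (y - jpoly p a) \<le> e" by blast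
  qed
  then show ?thesis ..
qed

lemma jb_approx_norm_eq:
  assumes "jb_approx a f y" "continuous_on (jb_spectrum a) f"
  shows "norm y = (SUP t\<in>jb_spectrum a. \<bar>f t\<bar>)"
proof (rule antisym)
  have bdd: "bdd_above ((\<lambda>t. \<bar>f t\<bar>) ` jb_spectrum a)"
    by (rule bdd_aboveI2[of _ _ "norm y"]) (rule jb_approx_abs_le_norm[OF assms(1)])
  show "norm y \<le> (SUP t\<in>jb_spectrum a. \<bar>f t\<bar>)"
    by (rule jb_approx_norm_le[OF assms(1)]) (rule cSUP_upper[OF _ bdd])
  show "(SUP t\<in>jb_spectrum a. \<bar>f t\<bar>) \<le> norm y"
    by (rule cSUP_least[OF jb_spectrum_nonempty]) (rule jb_approx_abs_le_norm[OF assms(1)])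
qed

lemma functional_calculus_exists: "\<exists>\<Phi>. functional_calculus a \<Phi>"
proof -
  define \<Phi> where "\<Phi> f = (SOME y. jb_approx a f y)" for f
  have \<Phi>: "jb_approx a f (\<Phi> f)" if "continuous_on (jb_spectrum a) f" for f
    unfolding \<Phi>_def by (rule someI_ex[OF jb_approx_exists[OF that]])
  have eq: "\<Phi> f = y" if "jb_approx a f y" for f y
    unfolding \<Phi>_def using that jb_approx_unique by (metis someI)
  have "functional_calculus a \<Phi>"
    unfolding functional_calculus_def
  proof (intro conjI allI impI)
    show "\<Phi> (\<lambda>t. 1) = \<one>\<^sub>J"
      using eq[OF jb_approx_const[of a 1]] by simp
    show "\<Phi> (\<lambda>t. t) = a"
      by (rule eq[OF jb_approx_id])
  qed (blast intro: eq jb_approx_add jb_approx_mult jb_approx_scaleR \<Phi> jb_approx_norm_eq)+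
  then show ?thesis by blast
qed

text \<open>The homomorphism laws fix \<Phi> on polynomials and isometry extends this to all
  continuous functions. Hence every functional calculus gives the same values, and the definite
  description in \<open>jb_fun\<close> denotes.\<close>

lemma functional_calculus_approx:
  assumes \<Phi>: "functional_calculus a \<Phi>" and f: "continuous_on (jb_spectrum a) f"
  shows "jb_approx a f (\<Phi> f)"
proof -
  note fc = \<Phi>[unfolded functional_calculus_def]
  have poly: "\<Phi> (poly p) = jpoly p a" for p
  proof (induction p)
    case 0
    have "\<Phi> (\<lambda>t. 0 * 1) = 0 *\<^sub>R \<Phi> (\<lambda>t. 1)" using fc continuous_on_const by blast
    then show ?case by simp
  next
    case (pCons c p)
    have c: "\<Phi> (\<lambda>t. c * 1) = c *\<^sub>R \<Phi> (\<lambda>t. 1)" using fc continuous_on_const by blast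
    have p: "continuous_on (jb_spectrum a) (poly p)" by (intro continuous_intros)
    have m: "\<Phi> (\<lambda>t. t * poly p t) = \<Phi> (\<lambda>t. t) \<bullet>\<^sub>J \<Phi> (poly p)" using fc continuous_on_id p by blast
    have "continuous_on (jb_spectrum a) (\<lambda>t. c * 1)"
      "continuous_on (jb_spectrum a) (\<lambda>t. t * poly p t)" by (intro continuous_intros)+
    then have "\<Phi> (\<lambda>t. c * 1 + t * poly p t) = \<Phi> (\<lambda>t. c * 1) + \<Phi> (\<lambda>t. t * poly p t)"
      using fc by blast
    then have "\<Phi> (\<lambda>t. c + t * poly p t) = jpoly (pCons c p) a"
      using fc c m pCons.IH by simp
    moreover have "poly (pCons c p) = (\<lambda>t. c + t * poly p t)" by auto
    ultimately show ?case by simp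
  qed
  show ?thesis
    unfolding jb_approx_def
  proof (intro allI impI)
    fix e :: real assume e: "e > 0"
    then obtain p where p: "\<And>t. t \<in> jb_spectrum a \<Longrightarrow> \<bar>f t - poly p t\<bar> < e"
      using poly_dense_on_jb_spectrum[OF f] by blast
    have m: "continuous_on (jb_spectrum a) (\<lambda>t. -1 * poly p t)" by (intro continuous_intros)
    have "\<Phi> (\<lambda>t. f t + -1 * poly p t) = \<Phi> f + \<Phi> (\<lambda>t. -1 * poly p t)" using fc f m by blast
    also have "\<Phi> (\<lambda>t. -1 * poly p t) = (-1) *\<^sub>R \<Phi> (poly p)"
      using fc continuous_on_poly[OF continuous_on_id] by blast
    finally have eq: "\<Phi> (\<lambda>t. f t + -1 * poly p t) = \<Phi> f - jpoly p a" by (simp add: poly)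
    have "continuous_on (jb_spectrum a) (\<lambda>t. f t + -1 * poly p t)" by (intro continuous_intros f)
    then have "norm (\<Phi> f - jpoly p a) = (SUP t\<in>jb_spectrum a. \<bar>f t + -1 * poly p t\<bar>)"
      using fc unfolding eq[symmetric] by blast
    also have "\<dots> \<le> e" by (rule cSUP_least[OF jb_spectrum_nonempty]) (use p in fastforce)
    finally show "\<exists>p. (\<forall>t\<in>jb_spectrum a. \<bar>f t - poly p t\<bar> \<le> e) \<and> norm (\<Phi> f - jpoly p a) \<le> e"
      using p less_imp_le by blast
  qed
qed

lemma jb_fun_approx:
  assumes "continuous_on (jb_spectrum a) f"
  shows "jb_approx a f (jb_fun f a)"
proof -
  obtain \<Phi> where \<Phi>: "functional_calculus a \<Phi>" using functional_calculus_exists by blast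
  have "jb_fun f a = \<Phi> f"
    unfolding jb_fun_def
    using \<Phi> functional_calculus_approx[OF _ assms] jb_approx_unique
    by (intro the_equality) blast+
  with functional_calculus_approx[OF \<Phi> assms] show ?thesis by simp
qed

lemma jb_fun_eqI: "jb_approx a f y \<Longrightarrow> continuous_on (jb_spectrum a) f \<Longrightarrow> jb_fun f a = y"
  using jb_approx_unique jb_fun_approx by blast

lemma jb_fun_add:
  "continuous_on (jb_spectrum a) f \<Longrightarrow> continuous_on (jb_spectrum a) g \<Longrightarrow>
   jb_fun (\<lambda>t. f t + g t) a = jb_fun f a + jb_fun g a"
  by (intro jb_fun_eqI jb_approx_add jb_fun_approx continuous_intros)

lemma jb_fun_mult:
  "continuous_on (jb_spectrum a) f \<Longrightarrow> continuous_on (jb_spectrum a) g \<Longrightarrow>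
   jb_fun (\<lambda>t. f t * g t) a = jb_fun f a \<bullet>\<^sub>J jb_fun g a"
  by (intro jb_fun_eqI jb_approx_mult jb_fun_approx continuous_intros)

lemma jb_fun_scaleR:
  "continuous_on (jb_spectrum a) f \<Longrightarrow> jb_fun (\<lambda>t. r * f t) a = r *\<^sub>R jb_fun f a"
  by (intro jb_fun_eqI jb_approx_scaleR jb_fun_approx continuous_intros)

lemma jb_fun_const: "jb_fun (\<lambda>t. r) a = r *\<^sub>R \<one>\<^sub>J"
  by (intro jb_fun_eqI jb_approx_const continuous_intros)

lemma jb_fun_id: "jb_fun (\<lambda>t. t) a = a"
  by (intro jb_fun_eqI jb_approx_id continuous_intros)

lemma jb_fun_diff:
  "continuous_on (jb_spectrum a) f \<Longrightarrow> continuous_on (jb_spectrum a) g \<Longrightarrow>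
   jb_fun (\<lambda>t. f t - g t) a = jb_fun f a - jb_fun g a"
  using jb_fun_add[of f "\<lambda>t. -1 * g t"] jb_fun_scaleR[of g "-1"]
  by (simp add: continuous_on_minus)

lemma jb_fun_cong:
  assumes "continuous_on (jb_spectrum a) f" "\<And>t. t \<in> jb_spectrum a \<Longrightarrow> f t = g t"
  shows "jb_fun f a = jb_fun g a"
  using assms jb_fun_approx[OF assms(1)] continuous_on_cong[of "jb_spectrum a" _ f g]
  by (metis jb_approx_cong jb_fun_eqI)

lemma jb_fun_in_jb_gen: "continuous_on (jb_spectrum a) f \<Longrightarrow> jb_fun f a \<in> jb_gen a"
  using jb_approx_in_jb_gen jb_fun_approx by blast

lemma norm_jb_fun_le:
  "continuous_on (jb_spectrum a) f \<Longrightarrow> (\<And>t. t \<in> jb_spectrum a \<Longrightarrow> \<bar>f t\<bar> \<le> B) \<Longrightarrow>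
   norm (jb_fun f a) \<le> B"
  using jb_approx_norm_le jb_fun_approx by blast

lemma abs_le_norm_jb_fun:
  "continuous_on (jb_spectrum a) f \<Longrightarrow> t \<in> jb_spectrum a \<Longrightarrow> \<bar>f t\<bar> \<le> norm (jb_fun f a)"
  using jb_approx_abs_le_norm jb_fun_approx by blast

text \<open>The norm description of the cone transfers through the isometry to
  \<open>\<bar>N - f t\<bar> \<le> N\<close>; the converse uses the square root of
  \<open>f\<close>.\<close>

lemma jb_fun_in_cone_iff:
  assumes f: "continuous_on (jb_spectrum a) f"
  shows "jb_fun f a \<in> jb_cone \<longleftrightarrow> (\<forall>t\<in>jb_spectrum a. 0 \<le> f t)"
proof
  assume "jb_fun f a \<in> jb_cone"
  define N where "N = norm (jb_fun f a)"
  have "norm (N *\<^sub>R \<one>\<^sub>J - jb_fun f a) \<le> N"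
    unfolding N_def by (rule jb_cone_norm_bound) (use \<open>jb_fun f a \<in> jb_cone\<close> in auto)
  then have "norm (jb_fun (\<lambda>t. N - f t) a) \<le> N"
    by (simp add: jb_fun_diff jb_fun_const f)
  moreover have "continuous_on (jb_spectrum a) (\<lambda>t. N - f t)" by (intro continuous_intros f)
  ultimately have "\<bar>N - f t\<bar> \<le> N" if "t \<in> jb_spectrum a" for t
    using abs_le_norm_jb_fun[of "\<lambda>t. N - f t" t] that by linarith
  then show "\<forall>t\<in>jb_spectrum a. 0 \<le> f t" by (auto simp: abs_le_iff)
next
  assume pos: "\<forall>t\<in>jb_spectrum a. 0 \<le> f t"
  have s: "continuous_on (jb_spectrum a) (\<lambda>t. sqrt (f t))" by (intro continuous_intros f)
  have "jb_fun f a = jb_fun (\<lambda>t. sqrt (f t) * sqrt (f t)) a" by (rule jb_fun_cong[OF f]) (use pos in auto)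
  also have "\<dots> \<in> jb_cone" unfolding jb_fun_mult[OF s s] by (rule jb_cone_square)
  finally show "jb_fun f a \<in> jb_cone" .
qed

lemma jb_fun_le_iff:
  assumes "continuous_on (jb_spectrum a) f" "continuous_on (jb_spectrum a) g"
  shows "jb_fun f a \<le>\<^sub>J jb_fun g a \<longleftrightarrow> (\<forall>t\<in>jb_spectrum a. f t \<le> g t)"
  using jb_fun_in_cone_iff[of "\<lambda>t. g t - f t"] assms
  by (simp add: jb_le_def jb_fun_diff continuous_on_diff)

end

section \<open>Quadratic representation\<close>

text \<open>All multiplications involved commute, so this is an identity between polynomials in
  operators. Computing multiplication by (cd)^2 by \<open>jprod_triple\<close> in two ways gives a
  relation that eliminates the square of multiplication by cd, the term \<open>A\<close>; what
  remains is the product of the two quadratic operators.\<close>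

lemma quad_rep_mult:
  assumes "c \<in> jb_gen a" "d \<in> jb_gen a"
  shows "quad_rep (c \<bullet>\<^sub>J d) w = quad_rep c (quad_rep d w)"
proof -
  define A where "A = (c \<bullet>\<^sub>J d) \<bullet>\<^sub>J ((c \<bullet>\<^sub>J d) \<bullet>\<^sub>J w)"
  define B where "B = c \<bullet>\<^sub>J (d \<bullet>\<^sub>J ((c \<bullet>\<^sub>J d) \<bullet>\<^sub>J w))"
  define C where "C = c \<bullet>\<^sub>J (c \<bullet>\<^sub>J ((d \<bullet>\<^sub>J d) \<bullet>\<^sub>J w))"
  define D where "D = d \<bullet>\<^sub>J (d \<bullet>\<^sub>J ((c \<bullet>\<^sub>J c) \<bullet>\<^sub>J w))"
  define E where "E = (c \<bullet>\<^sub>J c) \<bullet>\<^sub>J ((d \<bullet>\<^sub>J d) \<bullet>\<^sub>J w)"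
  define F where "F = c \<bullet>\<^sub>J (c \<bullet>\<^sub>J (d \<bullet>\<^sub>J (d \<bullet>\<^sub>J w)))"
  define sq where "sq = ((c \<bullet>\<^sub>J d) \<bullet>\<^sub>J (c \<bullet>\<^sub>J d)) \<bullet>\<^sub>J w"
  note oc = jb_gen_operator_commute[of _ a]
  note mem = assms jb_gen_prod[OF assms] jb_gen_prod[OF assms(1,1)] jb_gen_prod[OF assms(2,2)]
  have dc: "d \<bullet>\<^sub>J c = c \<bullet>\<^sub>J d" by (rule jprod_commute)
  have G: "(c \<bullet>\<^sub>J (d \<bullet>\<^sub>J d)) \<bullet>\<^sub>J (c \<bullet>\<^sub>J w) = C + 2 *\<^sub>R B - 2 *\<^sub>R F"
  proof -
    have eq: "c \<bullet>\<^sub>J (d \<bullet>\<^sub>J d) = d \<bullet>\<^sub>J (d \<bullet>\<^sub>J c)" using assms by (metis jb_gen_operator_commute dc)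
    show ?thesis
      unfolding eq jprod_triple[of d d c "c \<bullet>\<^sub>J w"] B_def C_def F_def
      using mem by (simp add: oc dc scaleR_2)
  qed
  have H: "(d \<bullet>\<^sub>J (c \<bullet>\<^sub>J c)) \<bullet>\<^sub>J (d \<bullet>\<^sub>J w) = D + 2 *\<^sub>R B - 2 *\<^sub>R F"
  proof -
    have eq: "d \<bullet>\<^sub>J (c \<bullet>\<^sub>J c) = c \<bullet>\<^sub>J (c \<bullet>\<^sub>J d)" using assms by (metis jb_gen_operator_commute dc)
    show ?thesis
      unfolding eq jprod_triple[of c c d "d \<bullet>\<^sub>J w"] B_def D_def F_def
      using mem by (simp add: oc dc scaleR_2)
  qed
  have cd1: "(c \<bullet>\<^sub>J d) \<bullet>\<^sub>J d = c \<bullet>\<^sub>J (d \<bullet>\<^sub>J d)" and cd2: "(c \<bullet>\<^sub>J d) \<bullet>\<^sub>J c = d \<bullet>\<^sub>J (c \<bullet>\<^sub>J c)"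
    using assms by (simp_all add: jb_gen_assoc[of _ a] jb_gen_operator_commute[of d a c])
  have "(c \<bullet>\<^sub>J d) \<bullet>\<^sub>J (c \<bullet>\<^sub>J d) = c \<bullet>\<^sub>J (c \<bullet>\<^sub>J (d \<bullet>\<^sub>J d))"
    using assms by (simp add: jb_gen_assoc[of _ a] jb_gen_operator_commute[of d a c])
  then have "sq = (c \<bullet>\<^sub>J (c \<bullet>\<^sub>J (d \<bullet>\<^sub>J d))) \<bullet>\<^sub>J w" by (simp add: sq_def)
  also have "\<dots> = E + 2 *\<^sub>R ((c \<bullet>\<^sub>J (d \<bullet>\<^sub>J d)) \<bullet>\<^sub>J (c \<bullet>\<^sub>J w)) - 2 *\<^sub>R C"
    unfolding jprod_triple[of c c "d \<bullet>\<^sub>J d" w] E_def C_def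
    using mem by (simp add: oc scaleR_2)
  finally have sq1: "sq = E + 4 *\<^sub>R B - 4 *\<^sub>R F" by (simp add: G algebra_simps)
  have "sq = (c \<bullet>\<^sub>J (d \<bullet>\<^sub>J d)) \<bullet>\<^sub>J (c \<bullet>\<^sub>J w) + (d \<bullet>\<^sub>J (c \<bullet>\<^sub>J c)) \<bullet>\<^sub>J (d \<bullet>\<^sub>J w) + A - 2 *\<^sub>R B"
    unfolding sq_def jprod_triple[of "c \<bullet>\<^sub>J d" c d w] A_def B_def cd1 cd2
    using mem by (simp add: oc scaleR_2)
  then have "sq + 4 *\<^sub>R F + 2 *\<^sub>R B = A + C + D + 4 *\<^sub>R B"
    by (simp add: G H algebra_simps flip: scaleR_add_left)
  moreover have B4: "4 *\<^sub>R B = 2 *\<^sub>R B + 2 *\<^sub>R B" by (simp flip: scaleR_add_left)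
  ultimately have sq2: "sq = A + C + D + 2 *\<^sub>R B - 4 *\<^sub>R F" by (simp add: algebra_simps)
  have "quad_rep (c \<bullet>\<^sub>J d) w = 2 *\<^sub>R A - sq" by (simp add: quad_rep_def A_def sq_def)
  also have "\<dots> = 4 *\<^sub>R F - 2 *\<^sub>R C - 2 *\<^sub>R D + E"
  proof -
    have "A + C + D + 2 *\<^sub>R B = E + 4 *\<^sub>R B" using sq1 sq2 by (simp add: algebra_simps)
    then have "A + C + D = E + 2 *\<^sub>R B" by (simp add: B4)
    then have A_eq: "A = E + 2 *\<^sub>R B - C - D" by (simp add: algebra_simps)
    show ?thesis unfolding sq1 B4 A_eq by (simp add: scaleR_2 algebra_simps)
  qed
  also have "\<dots> = quad_rep c (quad_rep d w)"
    unfolding quad_rep_def C_def D_def E_def F_def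
    using mem by (simp add: jprod_simps oc algebra_simps)
  finally show ?thesis .
qed

lemma quad_rep_unit [simp]: "quad_rep \<one>\<^sub>J w = w"
  by (simp add: quad_rep_def scaleR_2)

lemma quad_rep_add: "quad_rep c (x + y) = quad_rep c x + quad_rep c y"
  by (simp add: quad_rep_def jprod_simps algebra_simps)

lemma quad_rep_scaleR: "quad_rep c (r *\<^sub>R x) = r *\<^sub>R quad_rep c x"
  by (simp add: quad_rep_def jprod_simps algebra_simps)

lemma quad_rep_diff: "quad_rep c (x - y) = quad_rep c x - quad_rep c y"
  by (simp add: quad_rep_def jprod_simps algebra_simps)

lemma norm_quad_rep_le: "norm (quad_rep c x) \<le> 3 * (norm c)\<^sup>2 * norm x"
proof -
  have "norm (c \<bullet>\<^sub>J (c \<bullet>\<^sub>J x)) \<le> norm c * (norm c * norm x)"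
    by (rule order_trans[OF norm_jprod_le]) (intro mult_left_mono norm_jprod_le norm_ge_zero)
  moreover have "norm ((c \<bullet>\<^sub>J c) \<bullet>\<^sub>J x) \<le> (norm c)\<^sup>2 * norm x"
    using norm_jprod_le[of "c \<bullet>\<^sub>J c" x] by (simp add: norm_jsquare)
  ultimately show ?thesis
    using norm_triangle_ineq4[of "2 *\<^sub>R (c \<bullet>\<^sub>J (c \<bullet>\<^sub>J x))" "(c \<bullet>\<^sub>J c) \<bullet>\<^sub>J x"]
    by (simp add: quad_rep_def power2_eq_square)
qed

text \<open>The operator sends \<open>y\<close> to y + 2ky + U_k y. The linear term, a priori of
  order \<open>norm k\<close>, is absorbed by \<open>y\<close> through
  \<open>jprod_lower_bound\<close>, so the loss is only quadratic in \<open>norm k\<close>: B from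
  that lemma and 3B from U_k y.\<close>

lemma quad_rep_near_unit:
  assumes "y \<in> jb_cone" "norm y \<le> B" "B > 0"
  shows "- (4 * B * (norm k)\<^sup>2) *\<^sub>R \<one>\<^sub>J \<le>\<^sub>J quad_rep (\<one>\<^sub>J + k) y"
proof -
  have eq: "quad_rep (\<one>\<^sub>J + k) y = y + 2 *\<^sub>R (k \<bullet>\<^sub>J y) + quad_rep k y"
    by (simp add: quad_rep_def jprod_simps algebra_simps scaleR_2)
  have "norm (quad_rep k y) \<le> 3 * B * (norm k)\<^sup>2"
    by (rule order_trans[OF norm_quad_rep_le]) (use mult_left_mono[OF assms(2), of "3 * (norm k)\<^sup>2"] in \<open>simp add: mult_ac\<close>)
  then have "- (3 * B * (norm k)\<^sup>2) *\<^sub>R \<one>\<^sub>J \<le>\<^sub>J - norm (quad_rep k y) *\<^sub>R \<one>\<^sub>J"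
    by (intro jb_le_unit_mono) simp
  also have "\<dots> \<le>\<^sub>J quad_rep k y" using neg_norm_jb_le[of "quad_rep k y"] by simp
  finally have "- (3 * B * (norm k)\<^sup>2) *\<^sub>R \<one>\<^sub>J \<le>\<^sub>J quad_rep k y" .
  from jb_le_add_mono[OF jprod_lower_bound[OF assms, of k] this]
  show ?thesis unfolding eq by (simp add: jb_le_def algebra_simps flip: scaleR_add_left)
qed

section \<open>The interior of the cone, real powers and positivity of U\<close>

lemma in_interior_jb_cone_iff: "x \<in> jb_cone_interior \<longleftrightarrow> (\<exists>\<epsilon>>0. \<epsilon> *\<^sub>R \<one>\<^sub>J \<le>\<^sub>J (x::'a::jb_algebra))"
proof
  assume "x \<in> jb_cone_interior"
  then obtain \<delta> where \<delta>: "\<delta> > 0" "ball x \<delta> \<subseteq> jb_cone" by (auto simp: mem_interior)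
  have "norm ((\<delta>/2) *\<^sub>R (\<one>\<^sub>J::'a)) < \<delta>"
    using mult_left_mono[OF norm_jb_unit_le[where 'a='a], of "\<delta>/2"] \<delta>(1) by simp
  then have "x - (\<delta>/2) *\<^sub>R \<one>\<^sub>J \<in> ball x \<delta>" by (simp add: dist_norm)
  with \<delta> show "\<exists>\<epsilon>>0. \<epsilon> *\<^sub>R \<one>\<^sub>J \<le>\<^sub>J x" by (intro exI[of _ "\<delta>/2"]) (auto simp: jb_le_def)
next
  assume "\<exists>\<epsilon>>0. \<epsilon> *\<^sub>R \<one>\<^sub>J \<le>\<^sub>J x"
  then obtain \<epsilon> where \<epsilon>: "\<epsilon> > 0" "\<epsilon> *\<^sub>R \<one>\<^sub>J \<le>\<^sub>J x" by blast
  have "y \<in> jb_cone" if "dist x y < \<epsilon>" for y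
  proof -
    have "- (\<epsilon> *\<^sub>R \<one>\<^sub>J) \<le>\<^sub>J y - x"
      using jb_le_trans[OF jb_le_unit_mono[of "- \<epsilon>" "- norm (y - x)"], of "y - x"]
        neg_norm_jb_le[of "y - x"] that
      by (simp add: dist_norm norm_minus_commute)
    from jb_le_add_mono[OF \<epsilon>(2) this] show ?thesis by (simp add: jb_nonneg_iff)
  qed
  then have "ball x \<epsilon> \<subseteq> jb_cone" by auto
  with \<epsilon>(1) show "x \<in> jb_cone_interior" by (auto simp: mem_interior)
qed

context
  fixes a :: "'a::jb_algebra"
  assumes nontriv: "(\<one>\<^sub>J :: 'a) \<noteq> 0" and a: "a \<in> jb_cone_interior"
begin

lemma spectrum_lower_bound: "\<epsilon> *\<^sub>R \<one>\<^sub>J \<le>\<^sub>J a \<Longrightarrow> t \<in> jb_spectrum a \<Longrightarrow> \<epsilon> \<le> t"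
  using jb_fun_le_iff[OF nontriv, of a "\<lambda>t. \<epsilon>" "\<lambda>t. t"] by (simp add: jb_fun_const[OF nontriv] jb_fun_id[OF nontriv])

lemma spectrum_pos: "t \<in> jb_spectrum a \<Longrightarrow> t > 0"
  using a spectrum_lower_bound by (force simp: in_interior_jb_cone_iff)

lemma continuous_on_ln_spectrum: "continuous_on (jb_spectrum a) ln"
  using spectrum_pos by (intro continuous_on_ln continuous_on_id) force

lemma jb_fun_in_interior:
  assumes f: "continuous_on (jb_spectrum a) f" and pos: "\<And>t. t \<in> jb_spectrum a \<Longrightarrow> f t > 0"
  shows "jb_fun f a \<in> jb_cone_interior"
proof -
  obtain s where s: "s \<in> jb_spectrum a" "\<And>t. t \<in> jb_spectrum a \<Longrightarrow> f s \<le> f t"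
    using continuous_attains_inf[OF compact_jb_spectrum[OF nontriv] jb_spectrum_nonempty[OF nontriv] f] by blast
  have "f s *\<^sub>R \<one>\<^sub>J \<le>\<^sub>J jb_fun f a"
    using jb_fun_le_iff[OF nontriv, of a "\<lambda>t. f s" f] f s(2) by (simp add: jb_fun_const[OF nontriv])
  then show ?thesis using pos[OF s(1)] by (auto simp: in_interior_jb_cone_iff)
qed

lemma continuous_on_powr_spectrum: "continuous_on (jb_spectrum a) (\<lambda>t. t powr s)"
  using spectrum_pos by (intro continuous_intros) force

lemma jb_powr_0: "a powr\<^sub>J 0 = \<one>\<^sub>J"
  using jb_fun_cong[OF nontriv continuous_on_powr_spectrum[of 0], of "\<lambda>t. 1"] spectrum_pos
  by (force simp: jb_powr_def jb_fun_const[OF nontriv])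

lemma jb_powr_1: "a powr\<^sub>J 1 = a"
  using jb_fun_cong[OF nontriv continuous_on_powr_spectrum[of 1], of "\<lambda>t. t"] spectrum_pos
  by (force simp: jb_powr_def jb_fun_id[OF nontriv])

lemma jb_powr_add: "a powr\<^sub>J (s + t) = a powr\<^sub>J s \<bullet>\<^sub>J a powr\<^sub>J t"
  unfolding jb_powr_def powr_add
  by (rule jb_fun_mult[OF nontriv continuous_on_powr_spectrum continuous_on_powr_spectrum])

lemma jb_powr_in_interior: "a powr\<^sub>J s \<in> jb_cone_interior"
  unfolding jb_powr_def by (rule jb_fun_in_interior[OF continuous_on_powr_spectrum]) (use spectrum_pos in force)

lemma jb_powr_in_jb_gen: "a powr\<^sub>J s \<in> jb_gen a"
  unfolding jb_powr_def by (rule jb_fun_in_jb_gen[OF nontriv continuous_on_powr_spectrum])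

lemma quad_rep_jb_powr_add:
  "quad_rep (a powr\<^sub>J (s + t)) x = quad_rep (a powr\<^sub>J s) (quad_rep (a powr\<^sub>J t) x)"
  unfolding jb_powr_add by (rule quad_rep_mult[OF jb_powr_in_jb_gen jb_powr_in_jb_gen])

lemma quad_rep_jb_powr_powr: "quad_rep (a powr\<^sub>J s) (a powr\<^sub>J t) = a powr\<^sub>J (2 * s + t)"
  unfolding quad_rep_def jb_powr_add[symmetric] by (simp add: scaleR_2 add_ac flip: mult_2)

text \<open>\<open>U_a\<close> is the \<open>n\<close>-th power of \<open>U\<close> at \<open>a^(1/n) = e + k\<close> with \<open>norm k = O(1/n)\<close>, and each
  factor is positive up to an error \<open>O(1/n\<^sup>2)\<close>.\<close>

lemma quad_rep_interior_nonneg: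
  assumes x: "x \<in> jb_cone"
  shows "quad_rep a x \<in> jb_cone"
proof -
  have "bounded (ln ` jb_spectrum a)"
    by (intro compact_imp_bounded compact_continuous_image continuous_on_ln_spectrum compact_jb_spectrum[OF nontriv])
  then obtain L where L: "\<And>t. t \<in> jb_spectrum a \<Longrightarrow> \<bar>ln t\<bar> \<le> L" and L0: "L > 0"
    by (auto simp: bounded_pos)
  \<comment> \<open>Bounds a^s from above and, inverted, from below for all
    \<open>\<bar>s\<bar> \<le> 2\<close>. Exponents up to 2 occur because the error terms below are
    multiples of a^(2s).\<close>
  define K where "K = exp (2 * L)"
  have K: "K \<ge> 1" using L0 by (simp add: K_def)
  have pw: "t powr s = exp (s * ln t)" if "t \<in> jb_spectrum a" for t s
    using spectrum_pos[OF that] by (simp add: powr_def)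
  have sl: "\<bar>s * ln t\<bar> \<le> 2 * L" if "t \<in> jb_spectrum a" "\<bar>s\<bar> \<le> 2" for s t
    unfolding abs_mult using L[OF that(1)] that(2) by (intro mult_mono) auto
  have norm_K: "norm (a powr\<^sub>J s) \<le> K" if "\<bar>s\<bar> \<le> 2" for s
    unfolding jb_powr_def
    by (rule norm_jb_fun_le[OF nontriv continuous_on_powr_spectrum]) (use sl[OF _ that] in \<open>auto simp: pw K_def abs_le_iff\<close>)
  have low_K: "\<one>\<^sub>J \<le>\<^sub>J K *\<^sub>R a powr\<^sub>J s" if "\<bar>s\<bar> \<le> 2" for s
  proof -
    have "inverse K \<le> t powr s" if t: "t \<in> jb_spectrum a" for t
      using sl[OF t \<open>\<bar>s\<bar> \<le> 2\<close>] by (simp add: pw[OF t] K_def abs_le_iff flip: exp_minus)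
    then have "inverse K *\<^sub>R \<one>\<^sub>J \<le>\<^sub>J a powr\<^sub>J s"
      using jb_fun_le_iff[OF nontriv, of a "\<lambda>t. inverse K" "\<lambda>t. t powr s"] continuous_on_powr_spectrum[of s]
      by (simp add: jb_fun_const[OF nontriv] jb_powr_def)
    from jb_le_scaleR_mono[OF this, of K] K show ?thesis by simp
  qed
  define \<kappa> where "\<kappa> = L * exp L"
  define k where "k n = a powr\<^sub>J (1 / real n) - \<one>\<^sub>J" for n
  have norm_k: "norm (k n) \<le> \<kappa> / real n" if n: "n \<ge> 1" for n
  proof -
    have k_eq: "k n = jb_fun (\<lambda>t. t powr (1 / real n) - 1) a"
      using jb_fun_diff[OF nontriv continuous_on_powr_spectrum[of "1 / real n"] continuous_on_const[of _ 1]]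
      by (simp add: k_def jb_powr_def jb_fun_const[OF nontriv])
    have "\<bar>t powr (1 / real n) - 1\<bar> \<le> \<kappa> / real n" if t: "t \<in> jb_spectrum a" for t
    proof -
      define u where "u = 1 / real n * ln t"
      have u: "\<bar>u\<bar> \<le> L / real n" using L[OF t] n by (simp add: u_def divide_right_mono abs_mult)
      also have "L / real n \<le> L" using n L0 by (simp add: divide_le_eq mult_le_cancel_left1)
      finally have uL: "\<bar>u\<bar> \<le> L" .
      have "\<bar>exp u - 1\<bar> \<le> \<bar>u\<bar> * exp \<bar>u\<bar>"
      proof (cases "u \<ge> 0")
        case True
        have "(1 - u) * exp u \<le> exp (- u) * exp u"
          using exp_ge_add_one_self[of "- u"] by (intro mult_right_mono) auto
        then have "exp u - 1 \<le> u * exp u" by (simp add: algebra_simps flip: exp_add)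
        then show ?thesis using True by simp
      next
        case False
        have "1 - exp u \<le> - u" using exp_ge_add_one_self[of u] by linarith
        also have "- u \<le> (- u) * exp (- u)" using False mult_left_mono[of 1 "exp (- u)" "- u"] by simp
        finally show ?thesis using False by simp
      qed
      also have "\<dots> \<le> (L / real n) * exp L" using u uL by (intro mult_mono) auto
      also have "\<dots> = \<kappa> / real n" by (simp add: \<kappa>_def)
      finally show ?thesis by (simp add: pw[OF t] u_def)
    qed
    then show ?thesis
      unfolding k_eq
      by (intro norm_jb_fun_le[OF nontriv] continuous_intros continuous_on_powr_spectrum)
  qed
  define B where "B = 3 * K\<^sup>2 * norm x + K"
  have B: "B > 0" using K by (simp add: B_def add_nonneg_pos)
  define C where "C = 4 * B * \<kappa>\<^sup>2 * K"
  have C: "C \<ge> 0" using B K by (simp add: C_def)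
  \<comment> \<open>The error after j factors is measured in multiples of a^(2j/n) instead of e,
    since the next factor maps this power exactly to a^(2(j+1)/n) and does not amplify the error.
    Each factor adds C/n^2, where the \<open>K\<close> in \<open>C\<close> converts e into that
    power; C \<le> n keeps the coefficient at most 1, so that \<open>B\<close> bounds
    \<open>y\<close>. At j = n the total error is C/n.\<close>
  have main: "quad_rep (a powr\<^sub>J (real j / real n)) x
       + (real j * C / (real n)\<^sup>2) *\<^sub>R a powr\<^sub>J (2 * (real j / real n)) \<in> jb_cone"
    if n: "n \<ge> 1" "C \<le> real n" and "j \<le> n" for n j
    using \<open>j \<le> n\<close>
  proof (induction j)
    case 0
    then show ?case using x by (simp add: jb_powr_0)
  next
    case (Suc j)
    define s where "s = real j / real n"
    define \<delta> where "\<delta> = real j * C / (real n)\<^sup>2"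
    define y where "y = quad_rep (a powr\<^sub>J s) x + \<delta> *\<^sub>R a powr\<^sub>J (2 * s)"
    have y: "y \<in> jb_cone" using Suc by (simp add: y_def s_def \<delta>_def)
    have s: "0 \<le> s" "s + 1 / real n \<le> 1" using Suc.prems by (auto simp: s_def divide_simps)
    then have s1: "s \<le> 1" using n by (smt (verit) divide_nonneg_nonneg of_nat_0_le_iff)
    have \<delta>: "0 \<le> \<delta>" "\<delta> \<le> 1"
    proof -
      have "\<delta> = s * (C / real n)" by (simp add: \<delta>_def s_def power2_eq_square)
      also have "\<dots> \<le> 1 * 1" using s s1 n C by (intro mult_mono) (auto simp: divide_le_eq)
      finally show "\<delta> \<le> 1" by simp
    qed (use C in \<open>simp add: \<delta>_def\<close>)
    have "norm y \<le> B"
    proof -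
      have "norm (quad_rep (a powr\<^sub>J s) x) \<le> 3 * K\<^sup>2 * norm x"
        using norm_K[of s] s s1
        by (intro order_trans[OF norm_quad_rep_le] mult_right_mono mult_left_mono power_mono) auto
      moreover have "norm (\<delta> *\<^sub>R a powr\<^sub>J (2 * s)) \<le> K"
        using mult_mono[OF \<delta>(2) norm_K[of "2 * s"]] \<delta> s s1 K by simp
      ultimately show ?thesis unfolding y_def B_def by (rule norm_triangle_mono)
    qed
    from quad_rep_near_unit[OF y this B, of "k n"]
    have 1: "- (4 * B * (norm (k n))\<^sup>2) *\<^sub>R \<one>\<^sub>J \<le>\<^sub>J quad_rep (a powr\<^sub>J (1 / real n)) y"
      by (simp add: k_def)
    have Uy: "quad_rep (a powr\<^sub>J (1 / real n)) y =
        quad_rep (a powr\<^sub>J (s + 1 / real n)) x + \<delta> *\<^sub>R a powr\<^sub>J (2 * (s + 1 / real n))"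
      by (simp add: y_def quad_rep_add quad_rep_scaleR quad_rep_jb_powr_powr
          flip: quad_rep_jb_powr_add) (simp add: algebra_simps)
    have "4 * B * (norm (k n))\<^sup>2 \<le> 4 * B * (\<kappa> / real n)\<^sup>2"
      using norm_k[OF n(1)] B by (intro mult_left_mono power_mono) auto
    also have "\<dots> = 4 * B * \<kappa>\<^sup>2 / (real n)\<^sup>2" by (simp add: power_divide)
    finally have "- (4 * B * \<kappa>\<^sup>2 / (real n)\<^sup>2) *\<^sub>R \<one>\<^sub>J \<le>\<^sub>J - (4 * B * (norm (k n))\<^sup>2) *\<^sub>R \<one>\<^sub>J"
      by (intro jb_le_unit_mono) simp
    from jb_le_trans[OF this 1]
    have 2: "quad_rep (a powr\<^sub>J (1 / real n)) y + (4 * B * \<kappa>\<^sup>2 / (real n)\<^sup>2) *\<^sub>R \<one>\<^sub>J \<in> jb_cone"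
      by (simp add: jb_le_def)
    have "(4 * B * \<kappa>\<^sup>2 / (real n)\<^sup>2) *\<^sub>R (K *\<^sub>R a powr\<^sub>J (2 * (s + 1 / real n)) - \<one>\<^sub>J) \<in> jb_cone"
      using low_K[of "2 * (s + 1 / real n)"] s B by (intro jb_cone_scaleR) (auto simp: jb_le_def)
    from jb_cone_add[OF 2 this]
    have 3: "quad_rep (a powr\<^sub>J (s + 1 / real n)) x +
        (\<delta> + C / (real n)\<^sup>2) *\<^sub>R a powr\<^sub>J (2 * (s + 1 / real n)) \<in> jb_cone"
      by (simp add: Uy C_def algebra_simps)
    have "s + 1 / real n = real (Suc j) / real n" by (simp add: s_def add_divide_distrib)
    moreover have "\<delta> + C / (real n)\<^sup>2 = real (Suc j) * C / (real n)\<^sup>2"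
      by (simp add: \<delta>_def add_divide_distrib algebra_simps)
    ultimately show ?case using 3 by simp
  qed
  have "quad_rep a x + (C / real n) *\<^sub>R a powr\<^sub>J 2 \<in> jb_cone" if "n \<ge> 1" "C \<le> real n" for n
    using main[OF that order_refl] that(1) by (simp add: jb_powr_1 power2_eq_square)
  then have "\<forall>\<^sub>F n in sequentially. quad_rep a x + (C / real n) *\<^sub>R a powr\<^sub>J 2 \<in> jb_cone"
    unfolding eventually_sequentially by (intro exI[of _ "max 1 (nat \<lceil>C\<rceil>)"]) (auto simp: le_nat_iff)
  moreover have "(\<lambda>n. quad_rep a x + (C / real n) *\<^sub>R a powr\<^sub>J 2) \<longlonglongrightarrow> quad_rep a x + 0 *\<^sub>R a powr\<^sub>J 2"
    by (intro tendsto_intros lim_const_over_n)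
  ultimately show ?thesis using Lim_in_closed_set[OF closed_jb_cone] by fastforce
qed

end

lemma quad_rep_nonneg:
  fixes c x :: "'a::jb_algebra"
  assumes c: "c \<in> jb_cone" and x: "x \<in> jb_cone"
  shows "quad_rep c x \<in> jb_cone"
proof (cases "(\<one>\<^sub>J::'a) = 0")
  case True
  have "v = (0::'a)" for v using jprod_unit_left[of v] by (simp only: True jprod.zero_left)
  then show ?thesis by (metis x)
next
  case False
  have "quad_rep (c + inverse (real (Suc n)) *\<^sub>R \<one>\<^sub>J) x \<in> jb_cone" for n
  proof (rule quad_rep_interior_nonneg[OF False _ x])
    show "c + inverse (real (Suc n)) *\<^sub>R \<one>\<^sub>J \<in> jb_cone_interior"
      unfolding in_interior_jb_cone_iff using c
      by (intro exI[of _ "inverse (real (Suc n))"]) (auto simp: jb_le_def)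
  qed
  moreover have "(\<lambda>n. quad_rep (c + inverse (real (Suc n)) *\<^sub>R \<one>\<^sub>J) x) \<longlonglongrightarrow> quad_rep (c + 0 *\<^sub>R \<one>\<^sub>J) x"
    unfolding quad_rep_def
    by (intro tendsto_intros jprod.tendsto LIMSEQ_inverse_real_of_nat)
  ultimately show ?thesis using closed_sequentially[OF closed_jb_cone] by fastforce
qed

section \<open>Thompson geodesics\<close>

text \<open>Positivity of \<open>U\<close> at \<open>t p + q\<close> for all \<open>t > 0\<close> makes the Peirce half component of \<open>x\<close>
  nonnegative; its square lies in the sum of the two other Peirce spaces and vanishes there.\<close>

lemma idempotent_jprod_eq_0:
  fixes x :: "'a::jb_algebra"
  assumes p: "p \<bullet>\<^sub>J p = p" and x: "x \<in> jb_cone" "x \<le>\<^sub>J k *\<^sub>R (\<one>\<^sub>J - p)"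
  shows "p \<bullet>\<^sub>J x = 0"
proof -
  define q where "q = \<one>\<^sub>J - p"
  have q: "q \<bullet>\<^sub>J q = q" by (simp add: q_def jprod_simps p)
  have p0: "p \<in> jb_cone" and q0: "q \<in> jb_cone"
    using jb_cone_square[of p] jb_cone_square[of q] by (simp_all add: p q)
  \<comment> \<open>U_p x is squeezed between 0 and k U_p q = 0.\<close>
  have "quad_rep p q = 0" by (simp add: quad_rep_def q_def jprod_simps p)
  moreover have "quad_rep p (k *\<^sub>R q - x) \<in> jb_cone"
    using x by (intro quad_rep_nonneg p0) (simp add: jb_le_def q_def)
  ultimately have "- quad_rep p x \<in> jb_cone" by (simp add: quad_rep_diff quad_rep_scaleR)
  with quad_rep_nonneg[OF p0 x(1)] have "quad_rep p x = 0" by (rule jb_cone_proper)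
  then have ppx: "2 *\<^sub>R (p \<bullet>\<^sub>J (p \<bullet>\<^sub>J x)) = p \<bullet>\<^sub>J x" by (simp add: quad_rep_def p)
  \<comment> \<open>The Peirce half component 4px - 4p(px) of \<open>x\<close>, simplified by
    \<open>ppx\<close>.\<close>
  define w where "w = 2 *\<^sub>R (p \<bullet>\<^sub>J x)"
  have pw: "p \<bullet>\<^sub>J w = (1/2) *\<^sub>R w" using ppx by (simp add: w_def jprod_simps)
  have qw: "q \<bullet>\<^sub>J w = (1/2) *\<^sub>R w"
    using pw by (simp add: q_def jprod_simps scaleR_half_double[of w] algebra_simps flip: scaleR_2)
  have "quad_rep p w = 0" "quad_rep q w = 0"
    by (simp_all add: quad_rep_def p q pw qw jprod_simps)
  note Uw = this
  have w0: "w \<in> jb_cone"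
  proof -
    have "w + inverse (real (Suc n)) *\<^sub>R quad_rep q x \<in> jb_cone" for n
    proof -
      \<comment> \<open>U at tp + q maps \<open>x\<close> to t^2 U_p x + t w + U_q x with U_p x = 0;
        dividing by t and letting t grow leaves \<open>w\<close>.\<close>
      define t where "t = real (Suc n)"
      have t: "t > 0" by (simp add: t_def)
      have "quad_rep (t *\<^sub>R p + q) x = t\<^sup>2 *\<^sub>R quad_rep p x
          + t *\<^sub>R (4 *\<^sub>R (p \<bullet>\<^sub>J x) - 4 *\<^sub>R (p \<bullet>\<^sub>J (p \<bullet>\<^sub>J x))) + quad_rep q x"
      proof -
        have 4: "4 *\<^sub>R v = 2 *\<^sub>R v + 2 *\<^sub>R v" for v :: 'a by (simp flip: scaleR_add_left)
        show ?thesis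
          unfolding 4 quad_rep_def q_def
          by (simp add: jprod_simps p power2_eq_square algebra_simps)
      qed
      also have "4 *\<^sub>R (p \<bullet>\<^sub>J (p \<bullet>\<^sub>J x)) = 2 *\<^sub>R (2 *\<^sub>R (p \<bullet>\<^sub>J (p \<bullet>\<^sub>J x)))" by simp
      also have "4 *\<^sub>R (p \<bullet>\<^sub>J x) - 2 *\<^sub>R (2 *\<^sub>R (p \<bullet>\<^sub>J (p \<bullet>\<^sub>J x))) = w"
        unfolding ppx w_def by (simp flip: scaleR_diff_left)
      finally have "quad_rep (t *\<^sub>R p + q) x = t *\<^sub>R w + quad_rep q x"
        using \<open>quad_rep p x = 0\<close> by simp
      moreover have "quad_rep (t *\<^sub>R p + q) x \<in> jb_cone"
        using p0 q0 t by (intro quad_rep_nonneg x jb_cone_add jb_cone_scaleR) auto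
      ultimately have "inverse t *\<^sub>R (t *\<^sub>R w + quad_rep q x) \<in> jb_cone"
        using t by (intro jb_cone_scaleR) auto
      then show ?thesis using t by (simp add: scaleR_add_right t_def)
    qed
    moreover have "(\<lambda>n. w + inverse (real (Suc n)) *\<^sub>R quad_rep q x) \<longlonglongrightarrow> w + 0 *\<^sub>R quad_rep q x"
      by (intro tendsto_intros LIMSEQ_inverse_real_of_nat)
    ultimately show ?thesis using closed_sequentially[OF closed_jb_cone] by fastforce
  qed
  define v where "v = w \<bullet>\<^sub>J w"
  have v0: "v \<in> jb_cone" by (simp add: v_def)
  have wp: "w \<bullet>\<^sub>J p = (1/2) *\<^sub>R w" using pw by (simp add: jprod_commute)
  \<comment> \<open>On the Peirce half space \<open>p\<close> acts as 1/2, and the linearised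
    identity turns this into p(pv) = pv: \<open>v\<close> has no half component.\<close>
  have ppv: "p \<bullet>\<^sub>J (p \<bullet>\<^sub>J v) = p \<bullet>\<^sub>J v"
    using jordan_identity_linearized1[of w p p] by (simp add: wp pw p v_def jprod_simps)
  have vw: "norm w *\<^sub>R w - v \<in> jb_cone"
    using square_jb_le[OF w0 order_refl] by (simp add: jb_le_def v_def)
  \<comment> \<open>0 \<le> v \<le> \<open>norm w *\<^sub>R w\<close>, and U_c annihilates
    \<open>w\<close>.\<close>
  have "quad_rep c v = 0" if "c \<in> jb_cone" "quad_rep c w = 0" for c
  proof (rule jb_cone_proper)
    show "- quad_rep c v \<in> jb_cone"
      using quad_rep_nonneg[OF that(1) vw] that(2) by (simp add: quad_rep_diff quad_rep_scaleR)
  qed (rule quad_rep_nonneg[OF that(1) v0])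
  with p0 q0 Uw have Uv: "quad_rep p v = 0" "quad_rep q v = 0" by blast+
  have pv: "p \<bullet>\<^sub>J v = 0" using Uv(1) by (simp add: quad_rep_def p ppv scaleR_2)
  then have "q \<bullet>\<^sub>J v = v" by (simp add: q_def jprod_simps)
  with Uv(2) have "v = 0" by (simp add: quad_rep_def q scaleR_2)
  then have "w = 0" using norm_jsquare[of w] by (simp add: v_def)
  then show ?thesis by (simp add: w_def)
qed

section \<open>Thompson's metric in terms of the order\<close>

lemma interior_jb_cone_nonneg: "x \<in> jb_cone_interior \<Longrightarrow> x \<in> jb_cone"
  using interior_subset by blast

text \<open>Closedness of the cone lets the inequality pass to the infimum; the set of admissible
  factors is nonempty because \<open>y\<close> is bounded below by a multiple of e.\<close>

lemma M_gauge_le_iff: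
  assumes y: "y \<in> jb_cone_interior" and \<beta>: "\<beta> > 0"
  shows "M_gauge x y \<le> \<beta> \<longleftrightarrow> x \<le>\<^sub>J \<beta> *\<^sub>R y"
proof
  have bdd: "bdd_below {\<beta>. 0 < \<beta> \<and> x \<le>\<^sub>J \<beta> *\<^sub>R y}" by (rule bdd_belowI[of _ 0]) auto
  { assume "x \<le>\<^sub>J \<beta> *\<^sub>R y"
    then show "M_gauge x y \<le> \<beta>" unfolding M_gauge_def using \<beta> by (intro cInf_lower bdd) auto }
  assume le: "M_gauge x y \<le> \<beta>"
  obtain \<epsilon> where \<epsilon>: "\<epsilon> > 0" "\<epsilon> *\<^sub>R \<one>\<^sub>J \<le>\<^sub>J y" using y by (auto simp: in_interior_jb_cone_iff)
  have "x \<le>\<^sub>J (norm x + 1) *\<^sub>R \<one>\<^sub>J"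
    by (rule jb_le_trans[OF jb_le_norm jb_le_unit_mono]) simp
  also have "(norm x + 1) *\<^sub>R \<one>\<^sub>J \<le>\<^sub>J ((norm x + 1) / \<epsilon>) *\<^sub>R y"
    using jb_le_scaleR_mono[OF \<epsilon>(2), of "(norm x + 1) / \<epsilon>"] \<epsilon>(1) by simp
  finally have ne: "{\<beta>. 0 < \<beta> \<and> x \<le>\<^sub>J \<beta> *\<^sub>R y} \<noteq> {}"
    using \<epsilon>(1) by (auto intro!: exI[of _ "(norm x + 1) / \<epsilon>"] divide_pos_pos add_nonneg_pos)
  have "x \<le>\<^sub>J (\<beta> + inverse (real (Suc n))) *\<^sub>R y" for n
  proof -
    have "Inf {\<beta>. 0 < \<beta> \<and> x \<le>\<^sub>J \<beta> *\<^sub>R y} < \<beta> + inverse (real (Suc n))"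
      using le unfolding M_gauge_def by (rule order_le_less_trans) simp
    then obtain \<beta>' where \<beta>': "x \<le>\<^sub>J \<beta>' *\<^sub>R y" "\<beta>' < \<beta> + inverse (real (Suc n))"
      using cInf_lessD[OF ne] by blast
    show ?thesis
      by (rule jb_le_trans[OF \<beta>'(1) jb_le_scaleR_left])
         (use \<beta>' y interior_jb_cone_nonneg in \<open>auto simp: jb_nonneg_iff\<close>)
  qed
  moreover have "(\<lambda>n. (\<beta> + inverse (real (Suc n))) *\<^sub>R y) \<longlonglongrightarrow> (\<beta> + 0) *\<^sub>R y"
    by (intro tendsto_intros LIMSEQ_inverse_real_of_nat)
  ultimately show "x \<le>\<^sub>J \<beta> *\<^sub>R y" using jb_le_limit[OF tendsto_const[of x]] by fastforce
qed

text \<open>Keeps the argument of \<open>ln\<close> in \<open>thompson_dist\<close> positive, where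
  \<open>ln\<close> and \<open>exp\<close> are inverse to each other.\<close>

lemma M_gauge_pos:
  fixes x y :: "'a::jb_algebra"
  assumes nontriv: "(\<one>\<^sub>J::'a) \<noteq> 0" and x: "x \<in> jb_cone_interior" and y: "y \<in> jb_cone_interior"
  shows "M_gauge x y > 0"
proof (rule ccontr)
  obtain \<epsilon> where \<epsilon>: "\<epsilon> > 0" "\<epsilon> *\<^sub>R \<one>\<^sub>J \<le>\<^sub>J x" using x by (auto simp: in_interior_jb_cone_iff)
  assume "\<not> M_gauge x y > 0"
  define \<beta> where "\<beta> = \<epsilon> / (2 * (norm y + 1))"
  have N: "norm y + 1 > 0" by (simp add: add_nonneg_pos)
  have \<beta>: "\<beta> > 0" using \<epsilon> N by (simp add: \<beta>_def)
  then have "x \<le>\<^sub>J \<beta> *\<^sub>R y" using \<open>\<not> M_gauge x y > 0\<close> M_gauge_le_iff[OF y \<beta>, of x] by simp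
  also have "\<dots> \<le>\<^sub>J \<beta> *\<^sub>R (norm y *\<^sub>R \<one>\<^sub>J)" using \<beta> by (intro jb_le_scaleR_mono jb_le_norm) simp
  finally have "\<epsilon> *\<^sub>R \<one>\<^sub>J \<le>\<^sub>J (\<beta> * norm y) *\<^sub>R (\<one>\<^sub>J::'a)" using jb_le_trans[OF \<epsilon>(2)] by simp
  then have "\<epsilon> \<le> \<beta> * norm y" by (rule unit_scaleR_jb_le_imp_le) (rule nontriv)
  also have "\<dots> < \<beta> * (2 * (norm y + 1))"
    by (intro mult_strict_left_mono \<beta>) (simp add: add_nonneg_pos)
  finally show False using N by (simp add: \<beta>_def)
qed

lemma thompson_dist_le_iff:
  fixes x y :: "'a::jb_algebra"
  assumes nontriv: "(\<one>\<^sub>J::'a) \<noteq> 0" and x: "x \<in> jb_cone_interior" and y: "y \<in> jb_cone_interior"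
  shows "thompson_dist x y \<le> \<delta> \<longleftrightarrow> x \<le>\<^sub>J exp \<delta> *\<^sub>R y \<and> y \<le>\<^sub>J exp \<delta> *\<^sub>R x"
proof -
  have "max (M_gauge x y) (M_gauge y x) > 0" using M_gauge_pos[OF nontriv x y] by simp
  then have "thompson_dist x y \<le> \<delta> \<longleftrightarrow> max (M_gauge x y) (M_gauge y x) \<le> exp \<delta>"
    unfolding thompson_dist_def by (metis exp_le_cancel_iff exp_ln)
  then show ?thesis by (simp add: M_gauge_le_iff x y)
qed

section \<open>Geodesics from the unit\<close>

context
  fixes b :: "'a::jb_algebra"
  assumes nontriv: "(\<one>\<^sub>J :: 'a) \<noteq> 0" and b: "b \<in> jb_cone_interior"
begin

definition expcalc :: "(real \<Rightarrow> real) \<Rightarrow> 'a" where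
  "expcalc u = jb_fun (\<lambda>t. exp (u t)) b"

lemma expcalc_in_interior: "continuous_on (jb_spectrum b) u \<Longrightarrow> expcalc u \<in> jb_cone_interior"
  unfolding expcalc_def by (intro jb_fun_in_interior[OF nontriv b] continuous_intros) auto

lemma expcalc_0: "expcalc (\<lambda>t. 0) = \<one>\<^sub>J"
  by (simp add: expcalc_def jb_fun_const[OF nontriv])

lemma expcalc_ln: "expcalc ln = b"
proof -
  have "continuous_on (jb_spectrum b) (\<lambda>t. exp (ln t))"
    by (intro continuous_intros continuous_on_ln_spectrum[OF nontriv b])
  then have "expcalc ln = jb_fun (\<lambda>t. t) b"
    unfolding expcalc_def using spectrum_pos[OF nontriv b] by (intro jb_fun_cong[OF nontriv]) auto
  then show ?thesis by (simp add: jb_fun_id[OF nontriv])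
qed

lemma thompson_dist_expcalc_le_iff:
  assumes u: "continuous_on (jb_spectrum b) u" and v: "continuous_on (jb_spectrum b) v"
  shows "thompson_dist (expcalc u) (expcalc v) \<le> \<delta> \<longleftrightarrow> (\<forall>t\<in>jb_spectrum b. \<bar>u t - v t\<bar> \<le> \<delta>)"
proof -
  have le: "expcalc u \<le>\<^sub>J exp \<delta> *\<^sub>R expcalc v \<longleftrightarrow> (\<forall>t\<in>jb_spectrum b. u t \<le> \<delta> + v t)"
    if u: "continuous_on (jb_spectrum b) u" and v: "continuous_on (jb_spectrum b) v" for u v
  proof -
    have cu: "continuous_on (jb_spectrum b) (\<lambda>t. exp (u t))"
      and cv: "continuous_on (jb_spectrum b) (\<lambda>t. exp (v t))"
      and cdv: "continuous_on (jb_spectrum b) (\<lambda>t. exp \<delta> * exp (v t))"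
      by (intro continuous_intros u v)+
    show ?thesis
      unfolding expcalc_def jb_fun_scaleR[OF nontriv cv, symmetric] jb_fun_le_iff[OF nontriv cu cdv]
      by (simp flip: exp_add)
  qed
  show ?thesis
    unfolding thompson_dist_le_iff[OF nontriv expcalc_in_interior[OF u] expcalc_in_interior[OF v]]
      le[OF u v] le[OF v u] by (auto simp: abs_le_iff)
qed

lemma thompson_dist_expcalc_eq:
  assumes u: "continuous_on (jb_spectrum b) u" and v: "continuous_on (jb_spectrum b) v"
    and le: "\<And>t. t \<in> jb_spectrum b \<Longrightarrow> \<bar>u t - v t\<bar> \<le> \<delta>"
    and t: "t \<in> jb_spectrum b" "\<bar>u t - v t\<bar> = \<delta>"
  shows "thompson_dist (expcalc u) (expcalc v) = \<delta>"
proof (rule antisym)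
  show "thompson_dist (expcalc u) (expcalc v) \<le> \<delta>" using thompson_dist_expcalc_le_iff[OF u v] le by blast
  show "\<delta> \<le> thompson_dist (expcalc u) (expcalc v)"
    using thompson_dist_expcalc_le_iff[OF u v, of "thompson_dist (expcalc u) (expcalc v)"] t by auto
qed

text \<open>For a sup norm it is enough that the path moves at constant speed \<open>r\<close> at
  one point of the spectrum and nowhere faster; this leaves the freedom that the perturbation
  exploits.\<close>

lemma thompson_geodesic_expcalc:
  assumes cont: "\<And>s. continuous_on (jb_spectrum b) (u s)"
    and u0: "u 0 = (\<lambda>t. 0)" and u1: "u 1 = ln" and r: "r \<ge> 0"
    and le: "\<And>s s' t. 0 \<le> s \<Longrightarrow> s \<le> 1 \<Longrightarrow> 0 \<le> s' \<Longrightarrow> s' \<le> 1 \<Longrightarrow> t \<in> jb_spectrum b \<Longrightarrow>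
      \<bar>u s t - u s' t\<bar> \<le> r * \<bar>s - s'\<bar>"
    and t: "t \<in> jb_spectrum b" "\<And>s s'. \<bar>u s t - u s' t\<bar> = r * \<bar>s - s'\<bar>"
  shows "thompson_geodesic \<one>\<^sub>J b ((\<lambda>s. expcalc (u s)) ` {0..1})"
  unfolding geodesic_between_def geodesic_path_def
proof (intro exI conjI ballI)
  show "(0::real) \<le> 1" by simp
  show "is_interval {0..1::real}" by (rule is_interval_cc)
  show "(\<lambda>s. expcalc (u s)) ` {0..1} \<subseteq> jb_cone_interior" using expcalc_in_interior[OF cont] by blast
  show "r \<ge> 0" by fact
  show "expcalc (u 0) = \<one>\<^sub>J" by (simp add: u0 expcalc_0)
  show "expcalc (u 1) = b" by (simp add: u1 expcalc_ln)
  fix s s' :: real assume "s \<in> {0..1}" "s' \<in> {0..1}"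
  then show "thompson_dist (expcalc (u s)) (expcalc (u s')) = r * \<bar>s - s'\<bar>"
    by (intro thompson_dist_expcalc_eq[OF cont cont _ t(1)] le t(2)) auto
qed simp

lemma spectrum_of_unique_geodesic:
  assumes unique: "\<exists>!G. thompson_geodesic \<one>\<^sub>J b G" and not_scalar: "\<And>c. b \<noteq> c *\<^sub>R \<one>\<^sub>J"
  shows "\<exists>\<beta>>1. jb_spectrum b = {inverse \<beta>, \<beta>}"
proof -
  let ?\<sigma> = "jb_spectrum b"
  note ln = continuous_on_ln_spectrum[OF nontriv b]
  have "continuous_on ?\<sigma> (\<lambda>t. \<bar>ln t\<bar>)" by (intro continuous_intros ln)
  then obtain t0 where t0: "t0 \<in> ?\<sigma>" "\<And>t. t \<in> ?\<sigma> \<Longrightarrow> \<bar>ln t\<bar> \<le> \<bar>ln t0\<bar>"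
    using continuous_attains_sup[OF compact_jb_spectrum[OF nontriv] jb_spectrum_nonempty[OF nontriv]] by blast
  define r where "r = \<bar>ln t0\<bar>"
  have all_r: "\<bar>ln t\<bar> = r" if t: "t \<in> ?\<sigma>" for t
  proof (rule ccontr)
    assume "\<bar>ln t\<bar> \<noteq> r"
    then have r: "\<bar>ln t\<bar> < r" using t0(2)[OF t] by (simp add: r_def)
    \<comment> \<open>A tent: zero at both ends, so the endpoints stay fixed, and 1-Lipschitz, so
      the added speed is at most r - |ln|.\<close>
    define m where "m s = min s (1 - s)" for s :: real
    have m: "\<bar>m s - m s'\<bar> \<le> \<bar>s - s'\<bar>" for s s' by (auto simp: m_def)
    \<comment> \<open>Where \<open>\<bar>ln\<bar>\<close> is below its maximum \<open>r\<close> the second path may use up the slack in speed.\<close>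
    define u1 where "u1 s t = s * ln t" for s t :: real
    define u2 where "u2 s t = s * ln t + m s * (r - \<bar>ln t\<bar>)" for s t :: real
    have c1: "continuous_on ?\<sigma> (u1 s)" for s unfolding u1_def by (intro continuous_intros ln)
    have c2: "continuous_on ?\<sigma> (u2 s)" for s unfolding u2_def by (intro continuous_intros ln)
    have at0: "\<bar>u1 s t0 - u1 s' t0\<bar> = r * \<bar>s - s'\<bar>" "\<bar>u2 s t0 - u2 s' t0\<bar> = r * \<bar>s - s'\<bar>" for s s'
      by (simp_all add: u1_def u2_def r_def abs_mult mult.commute flip: left_diff_distrib)
    have le1: "\<bar>u1 s x - u1 s' x\<bar> \<le> r * \<bar>s - s'\<bar>" if "x \<in> ?\<sigma>" for s s' x
      using t0(2)[OF that] by (simp add: u1_def r_def abs_mult mult.commute mult_right_mono flip: left_diff_distrib)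
    have le2: "\<bar>u2 s x - u2 s' x\<bar> \<le> r * \<bar>s - s'\<bar>" if "x \<in> ?\<sigma>" for s s' x
    proof -
      have rx: "r - \<bar>ln x\<bar> \<ge> 0" using t0(2)[OF that] by (simp add: r_def)
      have "u2 s x - u2 s' x = (s - s') * ln x + (m s - m s') * (r - \<bar>ln x\<bar>)"
        by (simp add: u2_def algebra_simps)
      also have "\<bar>\<dots>\<bar> \<le> \<bar>s - s'\<bar> * \<bar>ln x\<bar> + \<bar>m s - m s'\<bar> * (r - \<bar>ln x\<bar>)"
        using abs_triangle_ineq[of "(s - s') * ln x" "(m s - m s') * (r - \<bar>ln x\<bar>)"] rx by (simp add: abs_mult)
      also have "\<dots> \<le> \<bar>s - s'\<bar> * \<bar>ln x\<bar> + \<bar>s - s'\<bar> * (r - \<bar>ln x\<bar>)"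
        using m[of s s'] rx by (intro add_left_mono mult_right_mono)
      also have "\<dots> = r * \<bar>s - s'\<bar>" by (simp add: algebra_simps)
      finally show ?thesis .
    qed
    have r0: "r > 0" using r by linarith
    have "thompson_geodesic \<one>\<^sub>J b ((\<lambda>s. expcalc (u1 s)) ` {0..1})"
      using r0 by (intro thompson_geodesic_expcalc[OF c1 _ _ _ le1 t0(1) at0(1)]) (auto simp: u1_def)
    moreover have "thompson_geodesic \<one>\<^sub>J b ((\<lambda>s. expcalc (u2 s)) ` {0..1})"
      using r0 by (intro thompson_geodesic_expcalc[OF c2 _ _ _ le2 t0(1) at0(2)]) (auto simp: u2_def m_def)
    ultimately have "(\<lambda>s. expcalc (u1 s)) ` {0..1} = (\<lambda>s. expcalc (u2 s)) ` {0..1}"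
      using unique by blast
    moreover have "expcalc (u2 (1/2)) \<in> (\<lambda>s. expcalc (u2 s)) ` {0..1}" by (rule imageI) simp
    ultimately have "expcalc (u2 (1/2)) \<in> (\<lambda>s. expcalc (u1 s)) ` {0..1}" by simp
    then obtain s where s: "s \<in> {0..1}" "expcalc (u2 (1/2)) = expcalc (u1 s)" by blast
    \<comment> \<open>Geodesics are images, so the midpoint of the second path could be any point of
      the first. Its distance from e forces the parameter 1/2, and at \<open>t\<close> the two
      midpoints differ by half of r - |ln t| > 0.\<close>
    have "u1 0 = u2 0" by (auto simp: u1_def u2_def m_def)
    then have "thompson_dist (expcalc (u1 s)) (expcalc (u1 0)) = thompson_dist (expcalc (u2 (1/2))) (expcalc (u2 0))"
      by (simp add: s(2))
    moreover have "thompson_dist (expcalc (u1 s)) (expcalc (u1 0)) = r * \<bar>s - 0\<bar>"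
      by (rule thompson_dist_expcalc_eq[OF c1 c1 le1 t0(1) at0(1)])
    moreover have "thompson_dist (expcalc (u2 (1/2))) (expcalc (u2 0)) = r * \<bar>1/2 - 0\<bar>"
      by (rule thompson_dist_expcalc_eq[OF c2 c2 le2 t0(1) at0(2)])
    ultimately have half: "s = 1/2" using r0 s(1) by simp
    have "thompson_dist (expcalc (u1 (1/2))) (expcalc (u2 (1/2))) = thompson_dist (expcalc (u1 (1/2))) (expcalc (u1 (1/2)))"
      by (simp only: s(2) half)
    also have "\<dots> \<le> 0" by (subst thompson_dist_expcalc_le_iff[OF c1 c1]) simp
    finally have "\<bar>u1 (1/2) t - u2 (1/2) t\<bar> \<le> 0"
      using t thompson_dist_expcalc_le_iff[OF c1 c2] by blast
    then show False using r by (simp add: u1_def u2_def m_def)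
  qed
  have sub: "t = exp (- r) \<or> t = exp r" if "t \<in> ?\<sigma>" for t
    using all_r[OF that] spectrum_pos[OF nontriv b that] by (metis abs_if exp_ln minus_minus)
  have not_single: "?\<sigma> \<noteq> {c}" for c
  proof
    assume "?\<sigma> = {c}"
    then have "jb_fun (\<lambda>t. t) b = jb_fun (\<lambda>t. c) b" by (intro jb_fun_cong[OF nontriv] continuous_intros) auto
    then show False using not_scalar by (simp add: jb_fun_id[OF nontriv] jb_fun_const[OF nontriv])
  qed
  have "r > 0"
  proof (rule ccontr)
    assume "\<not> r > 0"
    then have "r = 0" by (simp add: r_def)
    then have "?\<sigma> = {1}" using sub jb_spectrum_nonempty[OF nontriv, of b] by fastforce
    then show False using not_single by blast
  qed
  moreover have "?\<sigma> = {exp (- r), exp r}"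
    using sub not_single[of "exp (- r)"] not_single[of "exp r"] jb_spectrum_nonempty[OF nontriv, of b] by blast
  ultimately show ?thesis by (intro exI[of _ "exp r"]) (auto simp: exp_minus)
qed

lemma unique_geodesic_of_spectrum:
  assumes \<beta>: "\<beta> > 1" and \<sigma>: "jb_spectrum b = {inverse \<beta>, \<beta>}"
  shows "\<exists>!G. thompson_geodesic \<one>\<^sub>J b G"
proof -
  define r where "r = ln \<beta>"
  have r: "r > 0" using \<beta> by (simp add: r_def)
  have er: "exp r = \<beta>" using \<beta> by (simp add: r_def)
  have gt: "\<beta> > inverse \<beta>"
    using \<beta> by (smt (verit) inverse_less_1_iff)
  note ln = continuous_on_ln_spectrum[OF nontriv b]
  \<comment> \<open>On a finite spectrum every function is admissible.\<close>
  have cont: "continuous_on (jb_spectrum b) f" for f :: "real \<Rightarrow> real"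
    unfolding \<sigma> by (intro continuous_on_finite) simp
  have ln_r: "\<bar>ln t\<bar> = r" if "t \<in> jb_spectrum b" for t
    using that \<beta> r by (auto simp: \<sigma> r_def ln_inverse)
  \<comment> \<open>Parametrised by the distance \<rho> from e, so that every geodesic can be
    compared with it regardless of its interval and speed.\<close>
  define c where "c \<rho> = expcalc (\<lambda>t. (\<rho> / r) * ln t)" for \<rho>
  have dist_1b: "thompson_dist \<one>\<^sub>J b = r"
    using thompson_dist_expcalc_eq[OF cont cont, of "\<lambda>t. 0" ln r \<beta>] ln_r
    by (simp add: expcalc_0 expcalc_ln \<sigma>)
  have "thompson_geodesic \<one>\<^sub>J b ((\<lambda>s. expcalc (\<lambda>t. s * ln t)) ` {0..1})"
    by (rule thompson_geodesic_expcalc[OF cont, of _ r \<beta>])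
       (use r ln_r in \<open>auto simp: \<sigma> abs_mult mult.commute simp flip: left_diff_distrib\<close>)
  then obtain G where G: "thompson_geodesic \<one>\<^sub>J b G" by blast
  define d where "d = \<beta> - inverse \<beta>"
  have d: "d > 0" using gt by (simp add: d_def)
  \<comment> \<open>The affine function with value 1 at 1/\<beta> and 0 at \<beta>. On two points
    every function agrees with its affine interpolation, hence \<open>lin\<close>.\<close>
  define p where "p = jb_fun (\<lambda>t. (\<beta> - t) / d) b"
  define q where "q = \<one>\<^sub>J - p"
  have lin: "jb_fun f b = f (inverse \<beta>) *\<^sub>R p + f \<beta> *\<^sub>R q" for f
  proof -
    have q: "q = jb_fun (\<lambda>t. 1 - (\<beta> - t) / d) b"
      unfolding q_def p_def by (simp add: jb_fun_diff[OF nontriv cont cont] jb_fun_const[OF nontriv])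
    have "jb_fun f b = jb_fun (\<lambda>t. f (inverse \<beta>) * ((\<beta> - t) / d) + f \<beta> * (1 - (\<beta> - t) / d)) b"
      by (rule jb_fun_cong[OF nontriv cont]) (use d in \<open>auto simp: \<sigma> d_def\<close>)
    then show ?thesis
      by (simp only: jb_fun_add[OF nontriv cont cont] jb_fun_scaleR[OF nontriv cont] q p_def)
  qed
  have pp: "p \<bullet>\<^sub>J p = p"
    unfolding p_def jb_fun_mult[OF nontriv cont cont, symmetric]
    by (rule jb_fun_cong[OF nontriv cont]) (use d in \<open>auto simp: \<sigma> d_def\<close>)
  have qq: "q \<bullet>\<^sub>J q = q" by (simp add: q_def jprod_simps pp)
  have bpq: "b = inverse \<beta> *\<^sub>R p + \<beta> *\<^sub>R q" using lin[of "\<lambda>t. t"] by (simp add: jb_fun_id[OF nontriv])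
  have unit: "\<one>\<^sub>J = p + q" by (simp add: q_def)
  have c_eq: "c \<rho> = exp (- \<rho>) *\<^sub>R p + exp \<rho> *\<^sub>R q" for \<rho>
    using lin[of "\<lambda>t. exp (\<rho> / r * ln t)"] r \<beta> by (simp add: c_def expcalc_def ln_inverse flip: r_def)
  have point: "z = c \<rho>"
    if z: "z \<in> jb_cone_interior" and dz: "thompson_dist \<one>\<^sub>J z \<le> \<rho>" "thompson_dist z b \<le> r - \<rho>" for z \<rho>
  proof -
    define \<mu> where "\<mu> = exp \<rho>"
    have \<mu>: "\<mu> > 0" by (simp add: \<mu>_def)
    have one: "(\<one>\<^sub>J :: 'a) \<in> jb_cone_interior" using expcalc_in_interior[OF cont, of "\<lambda>t. 0"] by (simp add: expcalc_0)
    have rr: "exp (r - \<rho>) = \<beta> / \<mu>" by (simp add: exp_diff er \<mu>_def)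
    have 1: "\<one>\<^sub>J \<le>\<^sub>J \<mu> *\<^sub>R z" "z \<le>\<^sub>J \<mu> *\<^sub>R \<one>\<^sub>J"
      using dz(1) thompson_dist_le_iff[OF nontriv one z] by (auto simp: \<mu>_def)
    have 2: "z \<le>\<^sub>J (\<beta> / \<mu>) *\<^sub>R b" "b \<le>\<^sub>J (\<beta> / \<mu>) *\<^sub>R z"
      using dz(2) thompson_dist_le_iff[OF nontriv z b] by (auto simp: rr)
    define x where "x = z - inverse \<mu> *\<^sub>R \<one>\<^sub>J"
    define y where "y = \<mu> *\<^sub>R \<one>\<^sub>J - z"
    have x0: "x \<in> jb_cone"
      using jb_le_scaleR_mono[OF 1(1), of "inverse \<mu>"] \<mu> by (simp add: x_def jb_le_def)
    have y0: "y \<in> jb_cone" using 1(2) by (simp add: y_def jb_le_def)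
    \<comment> \<open>In (\<beta>/\<mu>) b - (1/\<mu>) e the coefficient of \<open>p\<close>
      cancels, so z \<le> (\<beta>/\<mu>) b bounds \<open>x\<close> by a multiple of
      \<open>q\<close> alone.\<close>
    have "((\<beta>\<^sup>2 - 1) / \<mu>) *\<^sub>R (\<one>\<^sub>J - p) - x = (\<beta> / \<mu>) *\<^sub>R b - z"
    proof -
      have coeffs: "(\<beta>\<^sup>2 - 1) / \<mu> + inverse \<mu> = \<beta> / \<mu> * \<beta>" "inverse \<mu> = \<beta> / \<mu> * inverse \<beta>"
        using \<mu> \<beta> by (simp_all add: field_simps power2_eq_square)
      have "((\<beta>\<^sup>2 - 1) / \<mu>) *\<^sub>R q + inverse \<mu> *\<^sub>R (p + q) =
          inverse \<mu> *\<^sub>R p + ((\<beta>\<^sup>2 - 1) / \<mu> + inverse \<mu>) *\<^sub>R q"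
        by (simp add: scaleR_add_right scaleR_add_left)
      also have "\<dots> = (\<beta> / \<mu>) *\<^sub>R (inverse \<beta> *\<^sub>R p + \<beta> *\<^sub>R q)"
        unfolding coeffs(1) by (simp only: coeffs(2) scaleR_add_right scaleR_scaleR)
      finally have "((\<beta>\<^sup>2 - 1) / \<mu>) *\<^sub>R q + inverse \<mu> *\<^sub>R (p + q) = (\<beta> / \<mu>) *\<^sub>R (inverse \<beta> *\<^sub>R p + \<beta> *\<^sub>R q)" .
      then show ?thesis unfolding x_def bpq q_def[symmetric] by (simp add: unit algebra_simps)
    qed
    then have px: "p \<bullet>\<^sub>J x = 0"
      using 2(1) by (intro idempotent_jprod_eq_0[OF pp x0, of "(\<beta>\<^sup>2 - 1) / \<mu>"]) (simp add: jb_le_def)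
    \<comment> \<open>Dually, \<mu> e - (\<mu>/\<beta>) b has no \<open>q\<close> part, so
      (\<mu>/\<beta>) b \<le> z bounds \<open>y\<close> by a multiple of \<open>p\<close>.\<close>
    have "(\<mu> * (1 - inverse \<beta> * inverse \<beta>)) *\<^sub>R (\<one>\<^sub>J - q) - y = (\<mu> / \<beta>) *\<^sub>R ((\<beta> / \<mu>) *\<^sub>R z - b)"
    proof -
      have "\<mu> *\<^sub>R (p + q) - (\<mu> * (1 - inverse \<beta> * inverse \<beta>)) *\<^sub>R p = (\<mu> / \<beta>) *\<^sub>R (inverse \<beta> *\<^sub>R p + \<beta> *\<^sub>R q)"
        using \<mu> \<beta> by (simp add: algebra_simps divide_inverse)
      then have "\<mu> *\<^sub>R (p + q) - (\<mu> * (1 - inverse \<beta> * inverse \<beta>)) *\<^sub>R p = (\<mu> / \<beta>) *\<^sub>R b"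
        by (simp only: bpq)
      moreover have "(\<mu> / \<beta>) *\<^sub>R ((\<beta> / \<mu>) *\<^sub>R z - b) = z - (\<mu> / \<beta>) *\<^sub>R b"
        using \<mu> \<beta> by (simp add: scaleR_diff_right)
      moreover have "\<one>\<^sub>J - q = p" by (simp add: q_def)
      ultimately show ?thesis unfolding y_def by (simp add: unit) (metis minus_diff_eq)
    qed
    moreover have "(\<mu> / \<beta>) *\<^sub>R ((\<beta> / \<mu>) *\<^sub>R z - b) \<in> jb_cone"
      using 2(2) \<mu> \<beta> by (intro jb_cone_scaleR) (auto simp: jb_le_def)
    ultimately have qy: "q \<bullet>\<^sub>J y = 0"
      by (intro idempotent_jprod_eq_0[OF qq y0, of "\<mu> * (1 - inverse \<beta> * inverse \<beta>)"]) (simp add: jb_le_def)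
    \<comment> \<open>As x + y is a scalar multiple of e, px = 0 gives the value of py; with qy = 0
      this determines \<open>y\<close>, hence \<open>z\<close>.\<close>
    have xy: "y = (\<mu> - inverse \<mu>) *\<^sub>R \<one>\<^sub>J - x" by (simp add: x_def y_def algebra_simps)
    have "y = (p + q) \<bullet>\<^sub>J y" by (simp flip: unit)
    also have "\<dots> = p \<bullet>\<^sub>J y" by (simp add: jprod_simps qy)
    also have "\<dots> = (\<mu> - inverse \<mu>) *\<^sub>R p" by (simp add: xy jprod_simps px)
    finally have "z = \<mu> *\<^sub>R (p + q) - (\<mu> - inverse \<mu>) *\<^sub>R p" by (simp add: y_def unit algebra_simps)
    then show ?thesis by (simp add: c_eq \<mu>_def exp_minus algebra_simps)
  qed
  have "G' = c ` {0..r}" if "thompson_geodesic \<one>\<^sub>J b G'" for G'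
  proof -
    from that obtain s t \<gamma> k where st: "s \<le> t" and \<gamma>: "\<gamma> ` {s..t} \<subseteq> jb_cone_interior"
      and k: "k \<ge> 0" "\<And>x y. x \<in> {s..t} \<Longrightarrow> y \<in> {s..t} \<Longrightarrow> thompson_dist (\<gamma> x) (\<gamma> y) = k * \<bar>x - y\<bar>"
      and ends: "\<gamma> s = \<one>\<^sub>J" "\<gamma> t = b" and G': "G' = \<gamma> ` {s..t}"
      unfolding geodesic_between_def geodesic_path_def by blast
    have kr: "k * (t - s) = r" using k(2)[of s t] st dist_1b by (simp add: ends)
    with r have k0: "k > 0" using k(1) by (metis less_irrefl mult_zero_left order_le_less)
    have \<gamma>_eq: "\<gamma> \<tau> = c (k * (\<tau> - s))" if \<tau>: "\<tau> \<in> {s..t}" for \<tau>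
    proof (rule point)
      show "\<gamma> \<tau> \<in> jb_cone_interior" using \<gamma> \<tau> by blast
      show "thompson_dist \<one>\<^sub>J (\<gamma> \<tau>) \<le> k * (\<tau> - s)"
        using k(2)[of s \<tau>] \<tau> st by (simp add: ends)
      show "thompson_dist (\<gamma> \<tau>) b \<le> r - k * (\<tau> - s)"
        using k(2)[of \<tau> t] \<tau> st kr by (simp add: ends algebra_simps)
    qed
    show ?thesis
    proof (intro equalityI subsetI)
      fix z assume "z \<in> G'"
      then obtain \<tau> where \<tau>: "\<tau> \<in> {s..t}" "z = \<gamma> \<tau>" by (auto simp: G')
      have "k * (\<tau> - s) \<le> k * (t - s)" using \<tau> k by (intro mult_left_mono) auto
      then show "z \<in> c ` {0..r}" using \<tau> k by (auto simp: \<gamma>_eq kr)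
    next
      fix z assume "z \<in> c ` {0..r}"
      then obtain \<rho> where \<rho>: "0 \<le> \<rho>" "\<rho> \<le> r" "z = c \<rho>" by auto
      have "\<rho> / k \<le> t - s" using \<rho>(2) k0 by (simp add: divide_le_eq mult.commute flip: kr)
      then have "s + \<rho> / k \<in> {s..t}" using \<rho> k0 by auto
      moreover from this have "\<gamma> (s + \<rho> / k) = z" using k0 \<rho> by (simp add: \<gamma>_eq)
      ultimately show "z \<in> G'" unfolding G' by blast
    qed
  qed
  with G show ?thesis by metis
qed

end

section \<open>Transport to the unit and conclusion\<close>

lemma geodesic_between_image:
  assumes "geodesic_between X d x y G"
    and "\<And>x. x \<in> X \<Longrightarrow> f x \<in> Y"
    and "\<And>x y. x \<in> X \<Longrightarrow> y \<in> X \<Longrightarrow> d' (f x) (f y) = d x y"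
  shows "geodesic_between Y d' (f x) (f y) (f ` G)"
proof -
  from assms(1) obtain s t \<gamma> k where st: "s \<le> t" "is_interval {s..t}" "\<gamma> ` {s..t} \<subseteq> X" "k \<ge> 0"
      "\<forall>u\<in>{s..t}. \<forall>v\<in>{s..t}. d (\<gamma> u) (\<gamma> v) = k * \<bar>u - v\<bar>"
      "\<gamma> s = x" "\<gamma> t = y" "G = \<gamma> ` {s..t}"
    unfolding geodesic_between_def geodesic_path_def by blast
  have "d' ((f \<circ> \<gamma>) u) ((f \<circ> \<gamma>) v) = k * \<bar>u - v\<bar>" if "u \<in> {s..t}" "v \<in> {s..t}" for u v
  proof -
    have "\<gamma> u \<in> X" "\<gamma> v \<in> X" using st(3) that by blast+
    then show ?thesis using assms(3)[of "\<gamma> u" "\<gamma> v"] st(5) that by simp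
  qed
  then have "geodesic_path Y d' {s..t} (f \<circ> \<gamma>)"
    unfolding geodesic_path_def using st(2,3,4) assms(2) by (auto simp del: is_interval_cc)
  moreover have "f ` G = (f \<circ> \<gamma>) ` {s..t}" by (simp add: st(8) image_comp)
  ultimately show ?thesis
    unfolding geodesic_between_def using st(1,6,7) by (metis comp_apply)
qed

text \<open>A positive operator with a positive left inverse reflects the order as well as
  preserving it, so both gauges are infima over the same sets.\<close>

lemma thompson_dist_quad_rep:
  assumes c: "c \<in> jb_cone" and d: "d \<in> jb_cone" and inv: "\<And>x. quad_rep d (quad_rep c x) = x"
  shows "thompson_dist (quad_rep c x) (quad_rep c y) = thompson_dist x y"
proof -
  have le: "quad_rep c x \<le>\<^sub>J \<beta> *\<^sub>R quad_rep c y \<longleftrightarrow> x \<le>\<^sub>J \<beta> *\<^sub>R y" for x y \<beta>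
    unfolding jb_le_def quad_rep_scaleR[symmetric] quad_rep_diff[symmetric]
    using quad_rep_nonneg[OF c] quad_rep_nonneg[OF d] inv by metis
  show ?thesis by (simp add: thompson_dist_def M_gauge_def le)
qed

text \<open>Linear independence of the pair is expressed by independence of the set together with
  \<open>a \<noteq> b\<close>, since for equal elements the set would be a singleton.\<close>

theorem theorem2p6:
  fixes a b :: "'a::jb_algebra"
  assumes "a \<in> jb_cone_interior" and "b \<in> jb_cone_interior"
    and "a \<noteq> b" and "independent {a, b}"
  shows "(\<exists>!G. thompson_geodesic a b G) \<longleftrightarrow>
    (\<exists>\<beta>>1. jb_spectrum (quad_rep (a powr\<^sub>J (- 1 / 2)) b) = {inverse \<beta>, \<beta>})"
proof -
  note a = assms(1) and b = assms(2)
  have "a \<noteq> 0" using assms(4) dependent_zero by blast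
  then have nontriv: "(\<one>\<^sub>J :: 'a) \<noteq> 0" using norm_jb_unit[of a] by auto
  note a' = nontriv a
  define T where "T = quad_rep (a powr\<^sub>J (- 1 / 2))"
  define S where "S = quad_rep (a powr\<^sub>J (1 / 2))"
  have ST: "S (T x) = x" and TS: "T (S x) = x" for x
    by (simp_all add: S_def T_def jb_powr_0[OF a'] flip: quad_rep_jb_powr_add[OF a'])
  have cone: "a powr\<^sub>J s \<in> jb_cone" for s
    by (rule interior_jb_cone_nonneg[OF jb_powr_in_interior[OF a']])
  have dist: "thompson_dist (T x) (T y) = thompson_dist x y" "thompson_dist (S x) (S y) = thompson_dist x y" for x y
    unfolding T_def S_def
    by (rule thompson_dist_quad_rep[OF cone cone ST[unfolded S_def T_def]],
        rule thompson_dist_quad_rep[OF cone cone TS[unfolded S_def T_def]])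
  have interior: "quad_rep (a powr\<^sub>J s) x \<in> jb_cone_interior" if x: "x \<in> jb_cone_interior" for s x
  proof -
    obtain \<epsilon> where \<epsilon>: "\<epsilon> > 0" "\<epsilon> *\<^sub>R \<one>\<^sub>J \<le>\<^sub>J x" using x by (auto simp: in_interior_jb_cone_iff)
    \<comment> \<open>The image of e is an interior point, and monotonicity of U carries \<epsilon>
      e \<le> x to a lower bound by \<epsilon> times this point.\<close>
    have "quad_rep (a powr\<^sub>J s) \<one>\<^sub>J = a powr\<^sub>J (2 * s)"
      using quad_rep_jb_powr_powr[OF a', of s 0] by (simp add: jb_powr_0[OF a'])
    then obtain \<delta> where \<delta>: "\<delta> > 0" "\<delta> *\<^sub>R \<one>\<^sub>J \<le>\<^sub>J quad_rep (a powr\<^sub>J s) \<one>\<^sub>J"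
      using jb_powr_in_interior[OF a', of "2 * s"] by (auto simp: in_interior_jb_cone_iff)
    have "\<epsilon> *\<^sub>R quad_rep (a powr\<^sub>J s) \<one>\<^sub>J \<le>\<^sub>J quad_rep (a powr\<^sub>J s) x"
      using quad_rep_nonneg[OF cone, of "x - \<epsilon> *\<^sub>R \<one>\<^sub>J" s] \<epsilon>(2)
      by (simp add: jb_le_def quad_rep_diff quad_rep_scaleR)
    with jb_le_scaleR_mono[OF \<delta>(2), of \<epsilon>] \<epsilon>(1)
    have "(\<epsilon> * \<delta>) *\<^sub>R \<one>\<^sub>J \<le>\<^sub>J quad_rep (a powr\<^sub>J s) x" using jb_le_trans by fastforce
    with \<epsilon>(1) \<delta>(1) show ?thesis unfolding in_interior_jb_cone_iff by (metis mult_pos_pos)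
  qed
  have Ta: "T a = \<one>\<^sub>J"
    using quad_rep_jb_powr_powr[OF a', of "- 1 / 2" 1] by (simp add: T_def jb_powr_0[OF a'] jb_powr_1[OF a'])
  have Sa: "S \<one>\<^sub>J = a" using ST[of a] by (simp add: Ta)
  have fwd: "thompson_geodesic \<one>\<^sub>J (T b) (T ` G)" if "thompson_geodesic a b G" for G
    using geodesic_between_image[OF that, of T jb_cone_interior thompson_dist] interior dist
    by (simp add: Ta) (simp add: T_def)
  have bwd: "thompson_geodesic a b (S ` G)" if "thompson_geodesic \<one>\<^sub>J (T b) G" for G
    using geodesic_between_image[OF that, of S jb_cone_interior thompson_dist] interior dist
    by (simp add: Sa ST) (simp add: S_def)
  have TS_image: "T ` (S ` G) = G" and ST_image: "S ` (T ` G) = G" for G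
    by (simp_all add: image_image ST TS)
  have ex1: "(\<exists>!G. thompson_geodesic a b G) \<longleftrightarrow> (\<exists>!G. thompson_geodesic \<one>\<^sub>J (T b) G)"
  proof
    assume "\<exists>!G. thompson_geodesic a b G"
    then obtain G where G: "thompson_geodesic a b G" "\<And>G'. thompson_geodesic a b G' \<Longrightarrow> G' = G" by blast
    have "G' = T ` G" if "thompson_geodesic \<one>\<^sub>J (T b) G'" for G'
      using G(2)[OF bwd[OF that]] TS_image[of G'] by simp
    with fwd[OF G(1)] show "\<exists>!G. thompson_geodesic \<one>\<^sub>J (T b) G" by (rule ex1I)
  next
    assume "\<exists>!G. thompson_geodesic \<one>\<^sub>J (T b) G"
    then obtain G where G: "thompson_geodesic \<one>\<^sub>J (T b) G"
      "\<And>G'. thompson_geodesic \<one>\<^sub>J (T b) G' \<Longrightarrow> G' = G" by blast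
    have "G' = S ` G" if "thompson_geodesic a b G'" for G'
      using G(2)[OF fwd[OF that]] ST_image[of G'] by simp
    with bwd[OF G(1)] show "\<exists>!G. thompson_geodesic a b G" by (rule ex1I)
  qed
  have Tb: "T b \<in> jb_cone_interior" unfolding T_def by (rule interior[OF b])
  \<comment> \<open>Applying \<open>S\<close> would make \<open>b\<close> a multiple of
    \<open>a\<close>; this excludes a one-point spectrum.\<close>
  have not_scalar: "T b \<noteq> c *\<^sub>R \<one>\<^sub>J" for c
  proof
    assume "T b = c *\<^sub>R \<one>\<^sub>J"
    then have "S (T b) = c *\<^sub>R S \<one>\<^sub>J" by (simp add: S_def quad_rep_scaleR)
    then have "b = c *\<^sub>R a" by (simp add: ST Sa)
    then have "b \<in> span ({a, b} - {b})" using assms(3) by (auto intro: span_base span_scale)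
    then show False using assms(4) unfolding dependent_def by blast
  qed
  have "(\<exists>!G. thompson_geodesic \<one>\<^sub>J (T b) G) \<longleftrightarrow> (\<exists>\<beta>>1. jb_spectrum (T b) = {inverse \<beta>, \<beta>})"
  proof
    assume "\<exists>!G. thompson_geodesic \<one>\<^sub>J (T b) G"
    then show "\<exists>\<beta>>1. jb_spectrum (T b) = {inverse \<beta>, \<beta>}"
      by (rule spectrum_of_unique_geodesic[OF nontriv Tb]) (rule not_scalar)
  next
    assume "\<exists>\<beta>>1. jb_spectrum (T b) = {inverse \<beta>, \<beta>}"
    then show "\<exists>!G. thompson_geodesic \<one>\<^sub>J (T b) G"
      by (elim exE conjE) (rule unique_geodesic_of_spectrum[OF nontriv Tb])
  qed
  then show ?thesis unfolding ex1 T_def .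
qed

end
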